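(* Let $X$ be a smooth complex projective irregular variety of dimension $n\geq 2$, and let $\mathcal{F}$ be a nonzero coherent sheaf on $X$. If $\mathcal{F}$ is continuously globally generated, then $\mathcal{F}$ has no essential basepoints.
   Context: A smooth complex projective variety $X$ is irregular if $h^1(X,\mathcal{O}_X)>0$. $\operatorname{Pic}^0(X)$ is the group of topologically trivial line bundles on $X$, $p^\vee$ is the dual of $p$, and $\mathbb{C}(x)$ is the skyscraper sheaf at $x$. A coherent sheaf $\mathcal{F}$ on $X$ is continuously globally generated if for every nonempty open subset $U\subseteq\operatorname{Pic}^0(X)$ the sum of evaluation maps $\bigoplus_{p\in U}H^0(X,\mathcal{F}\otimes p)\otimes p^{\vee}\to\mathcal{F}$ is surjective. A coherent sheaf $\mathcal{F}$ on $X$ has an essential basepoint at $x$ if there exists a surjective map $\mathcal{F}\to\mathbb{C}(x)$ such that for all $p\in\operatorname{Pic}^0(X)$ the induced map $H^0(X,\mathcal{F}\otimes p)\to H^0(X,\mathbb{C}(x))$ is zero. It has no essential basepoints if this happens at no $x\in X$. *)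

theory Defs
  imports "HOL-Analysis.Analysis" "HOL-Algebra.Module" "HOL-Algebra.Free_Abelian_Groups"
    "HOL-Library.Extended_Nat" "HOL-Library.Function_Algebras" "HOL-Library.Nat_Bijection"
begin

section \<open>Complex varieties in projective space\<close>

text \<open>Homogeneous coordinates are indexed by all natural numbers, and a point is a line through
  the origin with the origin removed, i.e. the set of all its homogeneous coordinate vectors.
  The space \<open>proj N\<close> consists of the lines whose coordinates after the \<open>N\<close>-th vanish; in this way
  the projective spaces of all dimensions have the same type of points.\<close>

type_synonym pt = "(nat \<Rightarrow> complex) set"

definition line :: "(nat \<Rightarrow> complex) \<Rightarrow> pt" where
  "line v = {\<lambda>i. c * v i |c. c \<noteq> 0}"

definition points :: "pt set" where
  "points = line ` {v. v \<noteq> (\<lambda>_. 0)}"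

definition proj :: "nat \<Rightarrow> pt set" where
  "proj N = line ` {v. v \<noteq> (\<lambda>_. 0) \<and> (\<forall>i>N. v i = 0)}"

text \<open>Over the infinite field of complex numbers, polynomials may be identified with polynomial
  functions. The zero function is homogeneous of every degree.\<close>

inductive homogeneous :: "nat \<Rightarrow> ((nat \<Rightarrow> complex) \<Rightarrow> complex) \<Rightarrow> bool" where
  const: "homogeneous 0 (\<lambda>_. c)"
| coord: "homogeneous 1 (\<lambda>v. v i)"
| add: "homogeneous d f \<Longrightarrow> homogeneous d g \<Longrightarrow> homogeneous d (\<lambda>v. f v + g v)"
| mult: "homogeneous d f \<Longrightarrow> homogeneous e g \<Longrightarrow> homogeneous (d + e) (\<lambda>v. f v * g v)"

definition zariski :: "pt topology" where
  "zariski = topology_generated_by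
     {{p \<in> points. \<forall>v\<in>p. f v \<noteq> 0} |f. \<exists>d. homogeneous d f}"

definition zar :: "pt set \<Rightarrow> pt topology" where
  "zar X = subtopology zariski X"

text \<open>The classical topology is the quotient topology of the nonzero vectors. On the vectors with
  coordinates supported in \<open>{..N}\<close>, the product topology is the Euclidean one.\<close>

definition classical :: "pt topology" where
  "classical = topology (\<lambda>U. U \<subseteq> points \<and> open {v. v \<noteq> (\<lambda>_. 0) \<and> line v \<in> U})"

lemma openin_classical:
  "openin classical U \<longleftrightarrow> U \<subseteq> points \<and> open {v. v \<noteq> (\<lambda>_. 0) \<and> line v \<in> U}"
proof -
  have "istopology (\<lambda>U. U \<subseteq> points \<and> open {v. v \<noteq> (\<lambda>_. 0) \<and> line v \<in> U})"
    unfolding istopology_def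
  proof (intro conjI allI impI)
    fix S T :: "pt set"
    assume S: "S \<subseteq> points \<and> open {v. v \<noteq> (\<lambda>_. 0) \<and> line v \<in> S}"
      and T: "T \<subseteq> points \<and> open {v. v \<noteq> (\<lambda>_. 0) \<and> line v \<in> T}"
    show "S \<inter> T \<subseteq> points" using S by blast
    have "{v. v \<noteq> (\<lambda>_. 0) \<and> line v \<in> S \<inter> T} =
        {v. v \<noteq> (\<lambda>_. 0) \<and> line v \<in> S} \<inter> {v. v \<noteq> (\<lambda>_. 0) \<and> line v \<in> T}"
      by blast
    then show "open {v. v \<noteq> (\<lambda>_. 0) \<and> line v \<in> S \<inter> T}" using S T by auto
  next
    fix K :: "pt set set"
    assume K: "\<forall>S\<in>K. S \<subseteq> points \<and> open {v. v \<noteq> (\<lambda>_. 0) \<and> line v \<in> S}"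
    show "\<Union>K \<subseteq> points" using K by blast
    have "{v. v \<noteq> (\<lambda>_. 0) \<and> line v \<in> \<Union>K} = (\<Union>S\<in>K. {v. v \<noteq> (\<lambda>_. 0) \<and> line v \<in> S})"
      by blast
    then show "open {v. v \<noteq> (\<lambda>_. 0) \<and> line v \<in> \<Union>K}" using K by auto
  qed
  then show ?thesis unfolding classical_def by (simp add: topology_inverse')
qed

definition irreducible_top :: "'p topology \<Rightarrow> bool" where
  "irreducible_top T \<longleftrightarrow> topspace T \<noteq> {} \<and>
     (\<forall>A B. closedin T A \<and> closedin T B \<and> A \<union> B = topspace T \<longrightarrow>
        A = topspace T \<or> B = topspace T)"

definition krull_dim :: "'p topology \<Rightarrow> enat" where
  "krull_dim T = Sup {enat n |n. \<exists>C :: nat \<Rightarrow> 'p set.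
     (\<forall>i\<le>n. closedin T (C i) \<and> irreducible_top (subtopology T (C i))) \<and>
     (\<forall>i<n. C i \<subset> C (Suc i))}"

definition quasi_projective_variety :: "pt set \<Rightarrow> bool" where
  "quasi_projective_variety X \<longleftrightarrow> irreducible_top (zar X) \<and>
     (\<exists>N C W. closedin (zar (proj N)) C \<and> openin (zar (proj N)) W \<and> X = C \<inter> W)"

definition projective_variety :: "pt set \<Rightarrow> bool" where
  "projective_variety X \<longleftrightarrow> irreducible_top (zar X) \<and> (\<exists>N. closedin (zar (proj N)) X)"

definition variety_dim :: "pt set \<Rightarrow> enat" where
  "variety_dim X = krull_dim (zar X)"

text \<open>The tangent space at the vector \<open>v\<close> of the affine cone over \<open>X\<close>: the common kernel of the
  differentials at \<open>v\<close> of the homogeneous polynomials that vanish on \<open>X\<close>.\<close>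

definition cone_tangent :: "pt set \<Rightarrow> (nat \<Rightarrow> complex) \<Rightarrow> (nat \<Rightarrow> complex) set" where
  "cone_tangent X v = {w. \<forall>d f. homogeneous d f \<and> (\<forall>p\<in>X. \<forall>u\<in>p. f u = 0) \<longrightarrow>
      deriv (\<lambda>t. f (\<lambda>i. v i + t * w i)) 0 = 0}"

text \<open>The Jacobian criterion, read on the cone (hence the shift by one): the Jacobian matrix of the
  equations of \<open>X\<close> in \<open>N + 1\<close> variables has rank \<open>N - dim X\<close> at each point.\<close>

definition smooth_projective_variety :: "pt set \<Rightarrow> bool" where
  "smooth_projective_variety X \<longleftrightarrow> projective_variety X \<and>
     (\<forall>p\<in>X. \<forall>v\<in>p.
        enat (vector_space.dim (\<lambda>(c::complex) w (i::nat). c * w i) (cone_tangent X v))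
          = eSuc (variety_dim X))"


section \<open>Regular functions and morphisms\<close>

text \<open>Regular functions on a (locally closed) set \<open>U\<close>; functions are taken to be undefined
  outside of \<open>U\<close>, so that equality of functions on \<open>U\<close> is equality.\<close>

definition regular_on :: "pt set \<Rightarrow> (pt \<Rightarrow> complex) \<Rightarrow> bool" where
  "regular_on U f \<longleftrightarrow> f \<in> extensional U \<and>
     (\<forall>x\<in>U. \<exists>W d a b. openin (zar U) W \<and> x \<in> W \<and> homogeneous d a \<and> homogeneous d b \<and>
        (\<forall>y\<in>W. \<forall>v\<in>y. b v \<noteq> 0 \<and> f y = a v / b v))"

definition reg :: "pt set \<Rightarrow> (pt \<Rightarrow> complex) ring" where
  "reg U = \<lparr>carrier = {f. regular_on U f},
     monoid.mult = (\<lambda>f g. \<lambda>x\<in>U. f x * g x), monoid.one = (\<lambda>x\<in>U. 1),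
     ring.zero = (\<lambda>x\<in>U. 0), ring.add = (\<lambda>f g. \<lambda>x\<in>U. f x + g x)\<rparr>"

definition morphism :: "pt set \<Rightarrow> pt set \<Rightarrow> (pt \<Rightarrow> pt) \<Rightarrow> bool" where
  "morphism X Y f \<longleftrightarrow> continuous_map (zar X) (zar Y) f \<and>
     (\<forall>V g. openin (zar Y) V \<and> g \<in> carrier (reg V) \<longrightarrow>
        (\<lambda>x\<in>{x\<in>X. f x \<in> V}. g (f x)) \<in> carrier (reg {x\<in>X. f x \<in> V}))"

text \<open>Products of varieties, through the Segre embedding.\<close>

definition segre :: "pt \<Rightarrow> pt \<Rightarrow> pt" where
  "segre x t = {\<lambda>k. v (fst (prod_decode k)) * w (snd (prod_decode k)) |v w. v \<in> x \<and> w \<in> t}"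

definition segre_prod :: "pt set \<Rightarrow> pt set \<Rightarrow> pt set" where
  "segre_prod X T = {segre x t |x t. x \<in> X \<and> t \<in> T}"

text \<open>The first Cech cohomology of the structure sheaf, as the direct limit over all open covers.
  It suffices to use covers \<open>(U x)\<close> indexed by the points of \<open>X\<close>, with \<open>x \<in> U x\<close>.
  The number \<open>h1_structure_sheaf X\<close> is the complex dimension of the limit: the supremum of the
  sizes of the finite families of classes (represented on a common cover) that are linearly
  independent, i.e. no nontrivial linear combination becomes a coboundary on a refinement.\<close>

definition point_cover :: "pt set \<Rightarrow> (pt \<Rightarrow> pt set) \<Rightarrow> bool" where
  "point_cover X U \<longleftrightarrow> (\<forall>x\<in>X. openin (zar X) (U x) \<and> x \<in> U x)"

definition cech_cocycle ::
  "pt set \<Rightarrow> (pt \<Rightarrow> pt set) \<Rightarrow> (pt \<Rightarrow> pt \<Rightarrow> pt \<Rightarrow> complex) \<Rightarrow> bool" where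
  "cech_cocycle X U c \<longleftrightarrow>
     (\<forall>x\<in>X. \<forall>y\<in>X. c x y \<in> carrier (reg (U x \<inter> U y))) \<and>
     (\<forall>x\<in>X. \<forall>y\<in>X. \<forall>z\<in>X. \<forall>q\<in>U x \<inter> U y \<inter> U z. c x y q + c y z q = c x z q)"

definition cech_coboundary ::
  "pt set \<Rightarrow> (pt \<Rightarrow> pt set) \<Rightarrow> (pt \<Rightarrow> pt \<Rightarrow> pt \<Rightarrow> complex) \<Rightarrow> bool" where
  "cech_coboundary X U c \<longleftrightarrow> (\<exists>b.
     (\<forall>x\<in>X. b x \<in> carrier (reg (U x))) \<and>
     (\<forall>x\<in>X. \<forall>y\<in>X. \<forall>q\<in>U x \<inter> U y. c x y q = b y q - b x q))"

definition h1_structure_sheaf :: "pt set \<Rightarrow> enat" where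
  "h1_structure_sheaf X = Sup {enat k |k. \<exists>U c. point_cover X U \<and>
     (\<forall>i<k. cech_cocycle X U (c i)) \<and>
     (\<forall>(a :: nat \<Rightarrow> complex) V.
        point_cover X V \<and> (\<forall>x\<in>X. V x \<subseteq> U x) \<and>
        cech_coboundary X V (\<lambda>x y q. \<Sum>i<k. a i * c i x y q) \<longrightarrow> (\<forall>i<k. a i = 0))}"

definition irregular :: "pt set \<Rightarrow> bool" where
  "irregular X \<longleftrightarrow> h1_structure_sheaf X > 0"


section \<open>Sheaves of modules\<close>

text \<open>The sections over \<open>U\<close> are a module in the sense of HOL-Algebra, whose record type extends that
  of rings; its multiplicative components are never used.\<close>

record 'a presheaf =
  sec :: "pt set \<Rightarrow> (pt \<Rightarrow> complex, 'a) module"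
  res :: "pt set \<Rightarrow> pt set \<Rightarrow> 'a \<Rightarrow> 'a"

definition module_presheaf :: "pt set \<Rightarrow> 'a presheaf \<Rightarrow> bool" where
  "module_presheaf X F \<longleftrightarrow>
     (\<forall>U. openin (zar X) U \<longrightarrow> Module.module (reg U) (sec F U)) \<and>
     (\<forall>U V. openin (zar X) U \<and> openin (zar X) V \<and> V \<subseteq> U \<longrightarrow>
        res F U V \<in> carrier (sec F U) \<rightarrow> carrier (sec F V) \<and>
        (\<forall>s\<in>carrier (sec F U). \<forall>t\<in>carrier (sec F U).
           res F U V (s \<oplus>\<^bsub>sec F U\<^esub> t) = res F U V s \<oplus>\<^bsub>sec F V\<^esub> res F U V t) \<and>
        (\<forall>f\<in>carrier (reg U). \<forall>s\<in>carrier (sec F U).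
           res F U V (f \<odot>\<^bsub>sec F U\<^esub> s) = restrict f V \<odot>\<^bsub>sec F V\<^esub> res F U V s)) \<and>
     (\<forall>U. openin (zar X) U \<longrightarrow> (\<forall>s\<in>carrier (sec F U). res F U U s = s)) \<and>
     (\<forall>U V W. openin (zar X) U \<and> openin (zar X) V \<and> openin (zar X) W \<and> W \<subseteq> V \<and> V \<subseteq> U \<longrightarrow>
        (\<forall>s\<in>carrier (sec F U). res F V W (res F U V s) = res F U W s))"

definition module_sheaf :: "pt set \<Rightarrow> 'a presheaf \<Rightarrow> bool" where
  "module_sheaf X F \<longleftrightarrow> module_presheaf X F \<and>
     (\<forall>\<U> s. (\<forall>U\<in>\<U>. openin (zar X) U \<and> s U \<in> carrier (sec F U)) \<and>
        (\<forall>U\<in>\<U>. \<forall>V\<in>\<U>. res F U (U \<inter> V) (s U) = res F V (U \<inter> V) (s V)) \<longrightarrow>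
        (\<exists>!t. t \<in> carrier (sec F (\<Union>\<U>)) \<and> (\<forall>U\<in>\<U>. res F (\<Union>\<U>) U t = s U)))"

definition sheaf_hom ::
  "pt set \<Rightarrow> 'a presheaf \<Rightarrow> 'b presheaf \<Rightarrow> (pt set \<Rightarrow> 'a \<Rightarrow> 'b) \<Rightarrow> bool" where
  "sheaf_hom X F G \<phi> \<longleftrightarrow>
     (\<forall>U. openin (zar X) U \<longrightarrow>
        \<phi> U \<in> carrier (sec F U) \<rightarrow> carrier (sec G U) \<and>
        (\<forall>s\<in>carrier (sec F U). \<forall>t\<in>carrier (sec F U).
           \<phi> U (s \<oplus>\<^bsub>sec F U\<^esub> t) = \<phi> U s \<oplus>\<^bsub>sec G U\<^esub> \<phi> U t) \<and>
        (\<forall>f\<in>carrier (reg U). \<forall>s\<in>carrier (sec F U).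
           \<phi> U (f \<odot>\<^bsub>sec F U\<^esub> s) = f \<odot>\<^bsub>sec G U\<^esub> \<phi> U s)) \<and>
     (\<forall>U V. openin (zar X) U \<and> openin (zar X) V \<and> V \<subseteq> U \<longrightarrow>
        (\<forall>s\<in>carrier (sec F U). \<phi> V (res F U V s) = res G U V (\<phi> U s)))"

definition sheaf_iso :: "pt set \<Rightarrow> 'a presheaf \<Rightarrow> 'b presheaf \<Rightarrow> bool" where
  "sheaf_iso X F G \<longleftrightarrow> (\<exists>\<phi>. sheaf_hom X F G \<phi> \<and>
     (\<forall>U. openin (zar X) U \<longrightarrow> bij_betw (\<phi> U) (carrier (sec F U)) (carrier (sec G U))))"

text \<open>A family \<open>I\<close> of sets of sections of \<open>G\<close> is everything locally. With \<open>I\<close> the images of the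
  components of a map of sheaves with target \<open>G\<close>, this is surjectivity of that map.\<close>

definition locally_all :: "pt set \<Rightarrow> 'b presheaf \<Rightarrow> (pt set \<Rightarrow> 'b set) \<Rightarrow> bool" where
  "locally_all X G I \<longleftrightarrow>
     (\<forall>U t. openin (zar X) U \<and> t \<in> carrier (sec G U) \<longrightarrow>
        (\<forall>x\<in>U. \<exists>V. openin (zar X) V \<and> x \<in> V \<and> V \<subseteq> U \<and> res G U V t \<in> I V))"

definition surjective_hom ::
  "pt set \<Rightarrow> 'a presheaf \<Rightarrow> 'b presheaf \<Rightarrow> (pt set \<Rightarrow> 'a \<Rightarrow> 'b) \<Rightarrow> bool" where
  "surjective_hom X F G \<phi> \<longleftrightarrow> sheaf_hom X F G \<phi> \<and>
     locally_all X G (\<lambda>U. \<phi> U ` carrier (sec F U))"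

definition nonzero_sheaf :: "pt set \<Rightarrow> 'a presheaf \<Rightarrow> bool" where
  "nonzero_sheaf X F \<longleftrightarrow>
     (\<exists>U. openin (zar X) U \<and> (\<exists>s\<in>carrier (sec F U). s \<noteq> \<zero>\<^bsub>sec F U\<^esub>))"

text \<open>Coherence as in Serre's FAC: \<open>F\<close> is of finite type, and so is the sheaf of relations between
  any finite number of sections over an open set.\<close>

definition finite_type :: "pt set \<Rightarrow> 'a presheaf \<Rightarrow> bool" where
  "finite_type X F \<longleftrightarrow>
     (\<forall>x\<in>X. \<exists>U (n::nat) s. openin (zar X) U \<and> x \<in> U \<and> (\<forall>i<n. s i \<in> carrier (sec F U)) \<and>
        (\<forall>V t. openin (zar X) V \<and> V \<subseteq> U \<and> t \<in> carrier (sec F V) \<longrightarrow>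
           (\<forall>y\<in>V. \<exists>W a. openin (zar X) W \<and> y \<in> W \<and> W \<subseteq> V \<and>
              (\<forall>i<n. a i \<in> carrier (reg W)) \<and>
              res F V W t = (\<Oplus>\<^bsub>sec F W\<^esub>i\<in>{..<n}. a i \<odot>\<^bsub>sec F W\<^esub> res F U W (s i)))))"

definition relations ::
  "'a presheaf \<Rightarrow> pt set \<Rightarrow> nat \<Rightarrow> (nat \<Rightarrow> 'a) \<Rightarrow> pt set \<Rightarrow> (nat \<Rightarrow> pt \<Rightarrow> complex) set" where
  "relations F U n s V = {a. (\<forall>i<n. a i \<in> carrier (reg V)) \<and>
     (\<Oplus>\<^bsub>sec F V\<^esub>i\<in>{..<n}. a i \<odot>\<^bsub>sec F V\<^esub> res F U V (s i)) = \<zero>\<^bsub>sec F V\<^esub>}"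

definition finite_type_relations ::
  "pt set \<Rightarrow> 'a presheaf \<Rightarrow> pt set \<Rightarrow> nat \<Rightarrow> (nat \<Rightarrow> 'a) \<Rightarrow> bool" where
  "finite_type_relations X F U n s \<longleftrightarrow>
     (\<forall>x\<in>U. \<exists>V (m::nat) r. openin (zar X) V \<and> x \<in> V \<and> V \<subseteq> U \<and>
        (\<forall>k<m. r k \<in> relations F U n s V) \<and>
        (\<forall>W a. openin (zar X) W \<and> W \<subseteq> V \<and> a \<in> relations F U n s W \<longrightarrow>
           (\<forall>y\<in>W. \<exists>W' b. openin (zar X) W' \<and> y \<in> W' \<and> W' \<subseteq> W \<and>
              (\<forall>k<m. b k \<in> carrier (reg W')) \<and>
              (\<forall>i<n. \<forall>z\<in>W'. a i z = (\<Sum>k<m. b k z * r k i z)))))"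

definition coherent_sheaf :: "pt set \<Rightarrow> 'a presheaf \<Rightarrow> bool" where
  "coherent_sheaf X F \<longleftrightarrow> module_sheaf X F \<and> finite_type X F \<and>
     (\<forall>U n s. openin (zar X) U \<and> (\<forall>i<n. s i \<in> carrier (sec F U)) \<longrightarrow>
        finite_type_relations X F U n s)"

definition skyscraper :: "pt \<Rightarrow> complex presheaf" where
  "skyscraper x = \<lparr>
     sec = (\<lambda>U. \<lparr>carrier = (if x \<in> U then UNIV else {0}),
       monoid.mult = undefined, monoid.one = undefined, ring.zero = 0, ring.add = (+),
       smult = (\<lambda>f c. if x \<in> U then f x * c else 0)\<rparr>),
     res = (\<lambda>U V c. if x \<in> V then c else 0)\<rparr>"

definition global_sections :: "pt set \<Rightarrow> 'a presheaf \<Rightarrow> 'a set" where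
  "global_sections X F = carrier (sec F X)"


section \<open>Tensor products\<close>

text \<open>The tensor product of two modules: the free abelian group on \<open>M \<times> N\<close> modulo the usual
  relations. Its elements are cosets.\<close>

abbreviation free_pairs ::
    "('r, 'a) module \<Rightarrow> ('r, 'b) module \<Rightarrow> (('a \<times> 'b) \<Rightarrow>\<^sub>0 int) monoid" where
  "free_pairs M N \<equiv> free_Abelian_group (carrier M \<times> carrier N)"

definition tensor_relations ::
    "'r ring \<Rightarrow> ('r, 'a) module \<Rightarrow> ('r, 'b) module \<Rightarrow> (('a \<times> 'b) \<Rightarrow>\<^sub>0 int) set" where
  "tensor_relations R M N = generate (free_pairs M N)
     ({frag_of (m \<oplus>\<^bsub>M\<^esub> m', n) - (frag_of (m, n) + frag_of (m', n)) |m m' n.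
         m \<in> carrier M \<and> m' \<in> carrier M \<and> n \<in> carrier N} \<union>
      {frag_of (m, n \<oplus>\<^bsub>N\<^esub> n') - (frag_of (m, n) + frag_of (m, n')) |m n n'.
         m \<in> carrier M \<and> n \<in> carrier N \<and> n' \<in> carrier N} \<union>
      {frag_of (r \<odot>\<^bsub>M\<^esub> m, n) - frag_of (m, r \<odot>\<^bsub>N\<^esub> n) |r m n.
         r \<in> carrier R \<and> m \<in> carrier M \<and> n \<in> carrier N})"

definition pure_tensor ::
    "'r ring \<Rightarrow> ('r, 'a) module \<Rightarrow> ('r, 'b) module \<Rightarrow> 'a \<Rightarrow> 'b \<Rightarrow> (('a \<times> 'b) \<Rightarrow>\<^sub>0 int) set" where
  "pure_tensor R M N m n = tensor_relations R M N #>\<^bsub>free_pairs M N\<^esub> frag_of (m, n)"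

text \<open>The additive map to the tensor product of \<open>M\<close> and \<open>N\<close> (over \<open>R\<close>) that sends the class of
  \<open>(m, n)\<close> to the class of \<open>(h m, k n)\<close>. If it is well defined, the union is over equal cosets.\<close>

definition tensor_map ::
    "'r ring \<Rightarrow> ('r, 'a) module \<Rightarrow> ('r, 'b) module \<Rightarrow> ('c \<Rightarrow> 'a) \<Rightarrow> ('d \<Rightarrow> 'b) \<Rightarrow>
     (('c \<times> 'd) \<Rightarrow>\<^sub>0 int) set \<Rightarrow> (('a \<times> 'b) \<Rightarrow>\<^sub>0 int) set" where
  "tensor_map R M N h k C = (\<Union>c\<in>C. tensor_relations R M N #>\<^bsub>free_pairs M N\<^esub>
      frag_extend (\<lambda>(m, n). frag_of (h m, k n)) c)"

definition tensor_module ::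
    "'r ring \<Rightarrow> ('r, 'a) module \<Rightarrow> ('r, 'b) module \<Rightarrow> ('r, (('a \<times> 'b) \<Rightarrow>\<^sub>0 int) set) module" where
  "tensor_module R M N = (let Q = free_pairs M N Mod tensor_relations R M N in
     \<lparr>carrier = carrier Q, monoid.mult = undefined, monoid.one = undefined,
      ring.zero = \<one>\<^bsub>Q\<^esub>, ring.add = (\<otimes>\<^bsub>Q\<^esub>),
      smult = (\<lambda>r. tensor_map R M N (\<lambda>m. r \<odot>\<^bsub>M\<^esub> m) (\<lambda>n. n))\<rparr>)"

definition tensor_presheaf ::
    "'a presheaf \<Rightarrow> 'b presheaf \<Rightarrow> (('a \<times> 'b) \<Rightarrow>\<^sub>0 int) set presheaf" where
  "tensor_presheaf F G = \<lparr>
     sec = (\<lambda>U. tensor_module (reg U) (sec F U) (sec G U)),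
     res = (\<lambda>U V. tensor_map (reg V) (sec F V) (sec G V) (res F U V) (res G U V))\<rparr>"

text \<open>Sheafification. The germ at \<open>x\<close> of a section \<open>s\<close> over \<open>U\<close> is its equivalence class; sections of
  the associated sheaf are the functions into germs that locally come from sections of \<open>P\<close>.\<close>

definition germ :: "pt set \<Rightarrow> 'a presheaf \<Rightarrow> pt \<Rightarrow> pt set \<Rightarrow> 'a \<Rightarrow> (pt set \<times> 'a) set" where
  "germ X P x U s = {(V, t). openin (zar X) V \<and> x \<in> V \<and> t \<in> carrier (sec P V) \<and>
     (\<exists>W. openin (zar X) W \<and> x \<in> W \<and> W \<subseteq> U \<inter> V \<and> res P U W s = res P V W t)}"

definition germ_add ::
    "pt set \<Rightarrow> 'a presheaf \<Rightarrow> pt \<Rightarrow> (pt set \<times> 'a) set \<Rightarrow> (pt set \<times> 'a) set \<Rightarrow> (pt set \<times> 'a) set" where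
  "germ_add X P x A B = (THE g. \<exists>U s t. openin (zar X) U \<and> x \<in> U \<and>
     s \<in> carrier (sec P U) \<and> t \<in> carrier (sec P U) \<and>
     A = germ X P x U s \<and> B = germ X P x U t \<and> g = germ X P x U (s \<oplus>\<^bsub>sec P U\<^esub> t))"

definition germ_smult ::
    "pt set \<Rightarrow> 'a presheaf \<Rightarrow> pt \<Rightarrow> pt set \<Rightarrow> (pt \<Rightarrow> complex) \<Rightarrow> (pt set \<times> 'a) set \<Rightarrow>
     (pt set \<times> 'a) set" where
  "germ_smult X P x U f A = (THE g. \<exists>V s. openin (zar X) V \<and> x \<in> V \<and> V \<subseteq> U \<and>
     s \<in> carrier (sec P V) \<and> A = germ X P x V s \<and>
     g = germ X P x V (restrict f V \<odot>\<^bsub>sec P V\<^esub> s))"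

definition sheafify :: "pt set \<Rightarrow> 'a presheaf \<Rightarrow> (pt \<Rightarrow> (pt set \<times> 'a) set) presheaf" where
  "sheafify X P = \<lparr>
     sec = (\<lambda>U. \<lparr>
       carrier = {s \<in> extensional U. \<forall>x\<in>U. \<exists>V t. openin (zar X) V \<and> x \<in> V \<and> V \<subseteq> U \<and>
          t \<in> carrier (sec P V) \<and> (\<forall>y\<in>V. s y = germ X P y V t)},
       monoid.mult = undefined, monoid.one = undefined,
       ring.zero = (\<lambda>x\<in>U. germ X P x U \<zero>\<^bsub>sec P U\<^esub>),
       ring.add = (\<lambda>s t. \<lambda>x\<in>U. germ_add X P x (s x) (t x)),
       smult = (\<lambda>f s. \<lambda>x\<in>U. germ_smult X P x U f (s x))\<rparr>),
     res = (\<lambda>U V s. restrict s V)\<rparr>"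

definition sheafify_map ::
    "pt set \<Rightarrow> 'a presheaf \<Rightarrow> 'b presheaf \<Rightarrow> (pt set \<Rightarrow> 'a \<Rightarrow> 'b) \<Rightarrow>
     pt set \<Rightarrow> (pt \<Rightarrow> (pt set \<times> 'a) set) \<Rightarrow> (pt \<Rightarrow> (pt set \<times> 'b) set)" where
  "sheafify_map X P Q \<phi> U s = (\<lambda>x\<in>U. THE g. \<exists>V t. openin (zar X) V \<and> x \<in> V \<and>
     t \<in> carrier (sec P V) \<and> s x = germ X P x V t \<and> g = germ X Q x V (\<phi> V t))"

type_synonym ('a, 'b) tensor_section =
  "pt \<Rightarrow> (pt set \<times> (('a \<times> 'b) \<Rightarrow>\<^sub>0 int) set) set"

definition tensor_sheaf ::
    "pt set \<Rightarrow> 'a presheaf \<Rightarrow> 'b presheaf \<Rightarrow> ('a, 'b) tensor_section presheaf" where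
  "tensor_sheaf X F G = sheafify X (tensor_presheaf F G)"

text \<open>For \<open>\<phi>\<close> a map from \<open>F\<close> to \<open>F'\<close>, the map \<open>\<phi> \<otimes> id\<close> from \<open>F \<otimes> G\<close> to \<open>F' \<otimes> G\<close>.\<close>

definition tensor_sheaf_map ::
    "pt set \<Rightarrow> 'a presheaf \<Rightarrow> 'c presheaf \<Rightarrow> 'b presheaf \<Rightarrow> (pt set \<Rightarrow> 'a \<Rightarrow> 'c) \<Rightarrow>
     pt set \<Rightarrow> ('a, 'b) tensor_section \<Rightarrow> ('c, 'b) tensor_section" where
  "tensor_sheaf_map X F F' G \<phi> = sheafify_map X (tensor_presheaf F G) (tensor_presheaf F' G)
     (\<lambda>U. tensor_map (reg U) (sec F' U) (sec G U) (\<phi> U) (\<lambda>n. n))"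


section \<open>Line bundles and the Picard variety\<close>

text \<open>A line bundle is given by an open cover \<open>U\<close> and transition functions \<open>g\<close>. Since varieties are
  quasi-compact, covers indexed by natural numbers (some members of which may be empty) give all
  line bundles up to isomorphism. Note that the cocycle condition implies \<open>g i i = 1\<close>.\<close>

type_synonym line_bundle_data = "(nat \<Rightarrow> pt set) \<times> (nat \<Rightarrow> nat \<Rightarrow> pt \<Rightarrow> complex)"

definition line_bundle :: "pt set \<Rightarrow> line_bundle_data \<Rightarrow> bool" where
  "line_bundle X L \<longleftrightarrow> (case L of (U, g) \<Rightarrow>
     (\<forall>i. openin (zar X) (U i)) \<and> (\<Union>i. U i) = X \<and>
     (\<forall>i j. g i j \<in> carrier (reg (U i \<inter> U j)) \<and> (\<forall>x\<in>U i \<inter> U j. g i j x \<noteq> 0)) \<and>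
     (\<forall>i j k. \<forall>x\<in>U i \<inter> U j \<inter> U k. g i j x * g j k x = g i k x))"

text \<open>The sheaf of sections: a section over \<open>V\<close> is the family of its local coordinates.\<close>

definition line_sheaf :: "line_bundle_data \<Rightarrow> (nat \<Rightarrow> pt \<Rightarrow> complex) presheaf" where
  "line_sheaf L = (case L of (U, g) \<Rightarrow> \<lparr>
     sec = (\<lambda>V. \<lparr>
       carrier = {s. (\<forall>i. s i \<in> carrier (reg (V \<inter> U i))) \<and>
         (\<forall>i j. \<forall>x\<in>V \<inter> U i \<inter> U j. s i x = g i j x * s j x)},
       monoid.mult = undefined, monoid.one = undefined,
       ring.zero = (\<lambda>i. \<lambda>x\<in>V \<inter> U i. 0),
       ring.add = (\<lambda>s t i. \<lambda>x\<in>V \<inter> U i. s i x + t i x),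
       smult = (\<lambda>f s i. \<lambda>x\<in>V \<inter> U i. f x * s i x)\<rparr>),
     res = (\<lambda>V W s i. restrict (s i) (W \<inter> U i))\<rparr>)"

definition dual_bundle :: "line_bundle_data \<Rightarrow> line_bundle_data" where
  "dual_bundle L = (case L of (U, g) \<Rightarrow> (U, \<lambda>i j. \<lambda>x\<in>U i \<inter> U j. inverse (g i j x)))"

text \<open>The pairing of a section \<open>l\<close> over \<open>V\<close> of the dual of \<open>L\<close> with a section \<open>a\<close> over \<open>V\<close> of \<open>L\<close>,
  computed in any one of the local trivialisations around the point.\<close>

definition pairing ::
    "line_bundle_data \<Rightarrow> pt set \<Rightarrow> (nat \<Rightarrow> pt \<Rightarrow> complex) \<Rightarrow> (nat \<Rightarrow> pt \<Rightarrow> complex) \<Rightarrow> pt \<Rightarrow> complex" where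
  "pairing L V l a = (\<lambda>x\<in>V. let i = (LEAST i. x \<in> fst L i) in l i x * a i x)"

text \<open>Topologically trivial: the underlying topological complex line bundle has a nowhere vanishing
  continuous section, here given by its local coordinates \<open>h\<close>.\<close>

definition topologically_trivial :: "line_bundle_data \<Rightarrow> bool" where
  "topologically_trivial L \<longleftrightarrow> (case L of (U, g) \<Rightarrow> \<exists>h :: nat \<Rightarrow> pt \<Rightarrow> complex.
     (\<forall>i. continuous_map (subtopology classical (U i)) euclidean (h i)) \<and>
     (\<forall>i. \<forall>x\<in>U i. h i x \<noteq> 0) \<and>
     (\<forall>i j. \<forall>x\<in>U i \<inter> U j. h i x = g i j x * h j x))"

definition bundle_class :: "pt set \<Rightarrow> line_bundle_data \<Rightarrow> line_bundle_data set" where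
  "bundle_class X L = {L'. line_bundle X L' \<and> sheaf_iso X (line_sheaf L) (line_sheaf L')}"

text \<open>The elements of \<open>Pic0 X\<close> are isomorphism classes.\<close>

definition Pic0 :: "pt set \<Rightarrow> line_bundle_data set set" where
  "Pic0 X = bundle_class X ` {L. line_bundle X L \<and> topologically_trivial L}"

text \<open>The restriction to \<open>X\<close>, identified with \<open>X \<times> {t}\<close>, of a line bundle on \<open>X \<times> T\<close>.\<close>

definition fibre_bundle :: "pt set \<Rightarrow> line_bundle_data \<Rightarrow> pt \<Rightarrow> line_bundle_data" where
  "fibre_bundle X L t = (case L of (U, g) \<Rightarrow>
     (\<lambda>i. {x\<in>X. segre x t \<in> U i},
      \<lambda>i j. \<lambda>x\<in>{x\<in>X. segre x t \<in> U i \<inter> U j}. g i j (segre x t)))"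

text \<open>A family over \<open>T\<close> of topologically trivial line bundles on \<open>X\<close>.\<close>

definition Pic0_family :: "pt set \<Rightarrow> pt set \<Rightarrow> line_bundle_data \<Rightarrow> bool" where
  "Pic0_family X T L \<longleftrightarrow> line_bundle (segre_prod X T) L \<and>
     (\<forall>t\<in>T. bundle_class X (fibre_bundle X L t) \<in> Pic0 X)"

text \<open>The Picard variety \<open>A\<close> of \<open>X\<close>, with Poincare bundle \<open>P\<close> on \<open>X \<times> A\<close>: the points of \<open>A\<close> correspond
  to the elements of \<open>Pic0 X\<close>, and all families are classified by morphisms to \<open>A\<close>. This
  determines \<open>A\<close> up to a unique isomorphism compatible with the bijection to \<open>Pic0 X\<close>.\<close>

definition picard_variety :: "pt set \<Rightarrow> pt set \<Rightarrow> line_bundle_data \<Rightarrow> bool" where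
  "picard_variety X A P \<longleftrightarrow> projective_variety A \<and> Pic0_family X A P \<and>
     bij_betw (\<lambda>a. bundle_class X (fibre_bundle X P a)) A (Pic0 X) \<and>
     (\<forall>T L. quasi_projective_variety T \<and> Pic0_family X T L \<longrightarrow>
        (\<exists>f. morphism T A f \<and> (\<forall>t\<in>T.
           bundle_class X (fibre_bundle X P (f t)) = bundle_class X (fibre_bundle X L t))))"

text \<open>Open subsets of \<open>Pic0 X\<close>, for its structure of an algebraic variety. As the Picard variety is
  unique, it does not matter which one is used, whence the universal quantifier.\<close>

definition Pic0_open :: "pt set \<Rightarrow> line_bundle_data set set \<Rightarrow> bool" where
  "Pic0_open X S \<longleftrightarrow> S \<subseteq> Pic0 X \<and>
     (\<forall>A P. picard_variety X A P \<longrightarrow>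
        openin (zar A) {a\<in>A. bundle_class X (fibre_bundle X P a) \<in> S})"


section \<open>Continuous global generation and essential basepoints\<close>

text \<open>The evaluation map from \<open>H\<^sup>0(X, F \<otimes> L) \<otimes> L\<^sup>\<or>\<close> to \<open>F\<close>, on \<open>s \<otimes> l\<close> with \<open>s\<close> a global section of
  \<open>F \<otimes> L\<close> and \<open>l\<close> a section over \<open>V\<close> of the dual of \<open>L\<close>: where \<open>s\<close> is the sum of the \<open>m k \<otimes> a k\<close>, the
  value is the sum of the \<open>\<langle>l, a k\<rangle> m k\<close>.\<close>

definition evaluation ::
    "pt set \<Rightarrow> 'a presheaf \<Rightarrow> line_bundle_data \<Rightarrow> pt set \<Rightarrow>
     ('a, nat \<Rightarrow> pt \<Rightarrow> complex) tensor_section \<Rightarrow> (nat \<Rightarrow> pt \<Rightarrow> complex) \<Rightarrow> 'a" where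
  "evaluation X F L V s l = (THE v. v \<in> carrier (sec F V) \<and>
     (\<forall>x\<in>V. \<exists>W (n::nat) m a. openin (zar X) W \<and> x \<in> W \<and> W \<subseteq> V \<and>
        (\<forall>k<n. m k \<in> carrier (sec F W) \<and> a k \<in> carrier (sec (line_sheaf L) W)) \<and>
        (\<forall>y\<in>W. s y = germ X (tensor_presheaf F (line_sheaf L)) y W
           (\<Oplus>\<^bsub>sec (tensor_presheaf F (line_sheaf L)) W\<^esub>k\<in>{..<n}.
              pure_tensor (reg W) (sec F W) (sec (line_sheaf L) W) (m k) (a k))) \<and>
        res F V W v = (\<Oplus>\<^bsub>sec F W\<^esub>k\<in>{..<n}.
           pairing L W (res (line_sheaf (dual_bundle L)) V W l) (a k) \<odot>\<^bsub>sec F W\<^esub> m k)))"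

text \<open>The image over \<open>V\<close> of the sum of the evaluation maps, for \<open>p\<close> ranging over the set \<open>S\<close> of
  isomorphism classes. An element of the direct sum is a finite sum of elements \<open>s \<otimes> l\<close> for
  various \<open>p\<close>; the image does not depend on the choice of the line bundle \<open>L\<close> in the class \<open>p\<close>.\<close>

definition evaluation_image ::
    "pt set \<Rightarrow> 'a presheaf \<Rightarrow> line_bundle_data set set \<Rightarrow> pt set \<Rightarrow> 'a set" where
  "evaluation_image X F S V =
     {\<Oplus>\<^bsub>sec F V\<^esub>k\<in>{..<n}. evaluation X F (L k) V (s k) (l k) |(n::nat) L s l.
        \<forall>k<n. (\<exists>p\<in>S. L k \<in> p) \<and>
          s k \<in> global_sections X (tensor_sheaf X F (line_sheaf (L k))) \<and>
          l k \<in> carrier (sec (line_sheaf (dual_bundle (L k))) V)}"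

definition continuously_globally_generated :: "pt set \<Rightarrow> 'a presheaf \<Rightarrow> bool" where
  "continuously_globally_generated X F \<longleftrightarrow>
     (\<forall>S. Pic0_open X S \<and> S \<noteq> {} \<longrightarrow> locally_all X F (evaluation_image X F S))"

text \<open>The induced map takes values in the sections of \<open>\<complex>(x) \<otimes> L\<close>, which is isomorphic to \<open>\<complex>(x)\<close> by a
  choice of basis of the fibre of \<open>L\<close> at \<open>x\<close>; whether the map is zero does not depend on it.\<close>

definition essential_basepoint :: "pt set \<Rightarrow> 'a presheaf \<Rightarrow> pt \<Rightarrow> bool" where
  "essential_basepoint X F x \<longleftrightarrow> (\<exists>\<phi>. surjective_hom X F (skyscraper x) \<phi> \<and>
     (\<forall>p\<in>Pic0 X. \<forall>L\<in>p. \<forall>s\<in>global_sections X (tensor_sheaf X F (line_sheaf L)).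
        tensor_sheaf_map X F (skyscraper x) (line_sheaf L) \<phi> X s =
          \<zero>\<^bsub>sec (tensor_sheaf X (skyscraper x) (line_sheaf L)) X\<^esub>))"

definition no_essential_basepoints :: "pt set \<Rightarrow> 'a presheaf \<Rightarrow> bool" where
  "no_essential_basepoints X F \<longleftrightarrow> (\<forall>x\<in>X. \<not> essential_basepoint X F x)"

end

theory Submission
  imports Defs
begin

text \<open>The set \<open>Pic0 X\<close> is itself open. If \<open>x\<close> were an essential basepoint for \<open>\<phi>\<close>, then the vanishing of
  \<open>H\<^sup>0(F \<otimes> L) \<rightarrow> H\<^sup>0(\<complex>(x) \<otimes> L)\<close>, contracted with sections of the dual of \<open>L\<close>, says that \<open>\<phi>\<close> kills the
  image of every evaluation map near \<open>x\<close>. These images generate \<open>F\<close> at \<open>x\<close>, so \<open>\<phi>\<close> would be zero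
  there, against its surjectivity.\<close>

section \<open>Tensor products of modules\<close>

text \<open>Tensors are cosets in a free abelian group, sections of \<open>F \<otimes> L\<close> are
  families of germs, and \<open>evaluation\<close> and \<open>tensor_sheaf_map\<close> are definite
  descriptions. Most of the work makes them computable: each must be well defined before its values
  can be discussed. This leads to finite sums of pure tensors, and two such sums may be equal
  without any correspondence between their terms. They are compared through the additive map that
  the universal property attaches to (m, a) \<mapsto> \<langle>l, a\<rangle> m. The vanishing at an
  essential basepoint is put into the same form. The zero tensor is the empty sum, so a vanishing
  germ is again an equality of two tensor sums, and the comparison that makes
  \<open>evaluation\<close> well defined for \<open>F\<close> also applies to \<complex>(x). Passing
  to smaller neighbourhoods of \<open>x\<close> loses nothing there: sections of \<complex>(x) over
  them are complex numbers, and restriction is the identity.\<close>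

lemma hom_finsum:
  fixes m :: "nat \<Rightarrow> 'a"
  assumes M: "abelian_group M" and N: "abelian_group N"
    and h: "h \<in> hom (add_monoid M) (add_monoid N)"
    and m: "\<And>k. k < n \<Longrightarrow> m k \<in> carrier M"
  shows "h (\<Oplus>\<^bsub>M\<^esub>k\<in>{..<n}. m k) = (\<Oplus>\<^bsub>N\<^esub>k\<in>{..<n}. h (m k))"
  using m
proof (induction n)
  case 0
  have "h \<one>\<^bsub>add_monoid M\<^esub> = \<one>\<^bsub>add_monoid N\<^esub>"
    by (rule hom_one[OF h]) (use M N in \<open>auto intro: abelian_group.a_group\<close>)
  then show ?case
    by (simp add: abelian_monoid.finsum_empty abelian_group.axioms(1) M N)
next
  case (Suc n)
  have MM: "abelian_monoid M" and NN: "abelian_monoid N"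
    using M N abelian_group.axioms(1) by auto
  have hm: "h (m k) \<in> carrier N" if "k < Suc n" for k
    using h Suc.prems[OF that] by (auto simp: hom_def)
  have "(\<Oplus>\<^bsub>M\<^esub>k\<in>{..<n}. m k) \<in> carrier M"
    using Suc.prems by (intro abelian_monoid.finsum_closed[OF MM]) auto
  then show ?case
    using Suc h hm
    by (simp add: lessThan_Suc abelian_monoid.finsum_insert[OF MM] abelian_monoid.finsum_insert[OF NN]
        Pi_iff hom_def)
qed

locale two_modules = M: module R M + N: module R N
  for R :: "'r ring" and M :: "('r, 'a) module" and N :: "('r, 'b) module"
begin

lemma subgroup_tensor_relations: "subgroup (tensor_relations R M N) (free_pairs M N)"
  unfolding tensor_relations_def
proof (rule group.generate_is_subgroup[OF group_free_Abelian_group], safe, goal_cases)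
  case (1 _ m m' n)
  then show ?case by (simp, intro order_trans[OF keys_diff] Un_least order_trans[OF keys_add]) auto
next
  case (2 _ m n n')
  then show ?case by (simp, intro order_trans[OF keys_diff] Un_least order_trans[OF keys_add]) auto
next
  case (3 _ r m n)
  then show ?case by (simp, intro order_trans[OF keys_diff] Un_least order_trans[OF keys_add]) auto
qed


lemma normal_tensor_relations: "tensor_relations R M N \<lhd> free_pairs M N"
  by (simp add: abelian_free_Abelian_group comm_group.normal_iff_subgroup subgroup_tensor_relations)

lemma tensor_relations_closed:
  assumes "c \<in> tensor_relations R M N" "d \<in> tensor_relations R M N"
  shows "c + d \<in> tensor_relations R M N" "c - d \<in> tensor_relations R M N" "- d \<in> tensor_relations R M N"
proof -
  have minus: "- d \<in> tensor_relations R M N" if "d \<in> tensor_relations R M N" for d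
  proof -
    have "Poly_Mapping.keys d \<subseteq> carrier M \<times> carrier N"
      using subsetD[OF subgroup.subset[OF subgroup_tensor_relations] that] by simp
    then show ?thesis
      using subgroup.m_inv_closed[OF subgroup_tensor_relations that] by simp
  qed
  have plus: "c + d \<in> tensor_relations R M N"
    if "c \<in> tensor_relations R M N" "d \<in> tensor_relations R M N" for c d
    using subgroup.m_closed[OF subgroup_tensor_relations that] by simp
  show "c + d \<in> tensor_relations R M N" "- d \<in> tensor_relations R M N"
    using minus plus assms by blast+
  show "c - d \<in> tensor_relations R M N"
    using plus[OF assms(1) minus[OF assms(2)]] by simp
qed

lemma coset_eq_iff:
  assumes "c \<in> carrier (free_pairs M N)" "d \<in> carrier (free_pairs M N)"
  shows "tensor_relations R M N #>\<^bsub>free_pairs M N\<^esub> c = tensor_relations R M N #>\<^bsub>free_pairs M N\<^esub> d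
    \<longleftrightarrow> c - d \<in> tensor_relations R M N"
proof
  assume "tensor_relations R M N #>\<^bsub>free_pairs M N\<^esub> c = tensor_relations R M N #>\<^bsub>free_pairs M N\<^esub> d"
  moreover have "c \<in> tensor_relations R M N #>\<^bsub>free_pairs M N\<^esub> c"
    using subgroup.one_closed[OF subgroup_tensor_relations] by (force simp: r_coset_def)
  ultimately show "c - d \<in> tensor_relations R M N"
    by (auto simp: r_coset_def)
next
  have "tensor_relations R M N #>\<^bsub>free_pairs M N\<^esub> c \<subseteq> tensor_relations R M N #>\<^bsub>free_pairs M N\<^esub> d"
    if "c - d \<in> tensor_relations R M N" for c d
  proof
    fix x assume "x \<in> tensor_relations R M N #>\<^bsub>free_pairs M N\<^esub> c"
    then obtain r where r: "r \<in> tensor_relations R M N" "x = r + c"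
      by (auto simp: r_coset_def)
    have "x = (r + (c - d)) + d"
      using r(2) by simp
    then show "x \<in> tensor_relations R M N #>\<^bsub>free_pairs M N\<^esub> d"
      using tensor_relations_closed(1)[OF r(1) that] 
      unfolding r_coset_def by (metis UN_I mult_free_Abelian_group singletonI)
  qed
  moreover assume cd: "c - d \<in> tensor_relations R M N"
  moreover from tensor_relations_closed(3)[OF cd cd] have "d - c \<in> tensor_relations R M N"
    by simp
  ultimately show "tensor_relations R M N #>\<^bsub>free_pairs M N\<^esub> c = tensor_relations R M N #>\<^bsub>free_pairs M N\<^esub> d"
    by blast
qed

lemma carrier_tensor_module:
  "carrier (tensor_module R M N) =
    (\<lambda>c. tensor_relations R M N #>\<^bsub>free_pairs M N\<^esub> c) ` carrier (free_pairs M N)"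
  by (simp add: tensor_module_def Let_def carrier_FactGroup)

lemma pure_tensor_closed:
  "m \<in> carrier M \<Longrightarrow> n \<in> carrier N \<Longrightarrow> pure_tensor R M N m n \<in> carrier (tensor_module R M N)"
  by (auto simp: carrier_tensor_module pure_tensor_def)

lemma coset_add:
  assumes "c \<in> carrier (free_pairs M N)" "d \<in> carrier (free_pairs M N)"
  shows "(tensor_relations R M N #>\<^bsub>free_pairs M N\<^esub> c) \<oplus>\<^bsub>tensor_module R M N\<^esub>
      (tensor_relations R M N #>\<^bsub>free_pairs M N\<^esub> d)
    = tensor_relations R M N #>\<^bsub>free_pairs M N\<^esub> (c + d)"
  using normal.rcos_sum[OF normal_tensor_relations assms]
  by (simp add: tensor_module_def Let_def)

lemma abelian_group_tensor_module: "abelian_group (tensor_module R M N)"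
proof -
  interpret Q: comm_group "free_pairs M N Mod tensor_relations R M N"
    by (rule comm_group.abelian_FactGroup[OF abelian_free_Abelian_group subgroup_tensor_relations])
  show ?thesis
  proof (rule abelian_groupI)
    fix t assume "t \<in> carrier (tensor_module R M N)"
    then show "\<exists>u\<in>carrier (tensor_module R M N).
        u \<oplus>\<^bsub>tensor_module R M N\<^esub> t = \<zero>\<^bsub>tensor_module R M N\<^esub>"
      using Q.l_inv Q.inv_closed unfolding tensor_module_def Let_def by (simp, blast)
  qed (use Q.m_closed Q.m_assoc Q.m_comm Q.one_closed Q.l_one in \<open>simp_all add: tensor_module_def Let_def\<close>)
qed

text \<open>The induction rule of \<open>generate\<close> in additive notation, with the three
  families of generators separated: what respects sums and negatives has to be checked only on
  biadditivity and balancing.\<close>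

lemma tensor_relations_induct [consumes 1, case_names zero plus minus add_l add_r scale]:
  assumes "c \<in> tensor_relations R M N"
    and zero: "P 0"
    and plus: "\<And>c d. c \<in> tensor_relations R M N \<Longrightarrow> d \<in> tensor_relations R M N \<Longrightarrow> P c \<Longrightarrow> P d \<Longrightarrow> P (c + d)"
    and minus: "\<And>c. c \<in> tensor_relations R M N \<Longrightarrow> P c \<Longrightarrow> P (- c)"
    and add_l: "\<And>m m' n. m \<in> carrier M \<Longrightarrow> m' \<in> carrier M \<Longrightarrow> n \<in> carrier N \<Longrightarrow>
      P (frag_of (m \<oplus>\<^bsub>M\<^esub> m', n) - (frag_of (m, n) + frag_of (m', n)))"
    and add_r: "\<And>m n n'. m \<in> carrier M \<Longrightarrow> n \<in> carrier N \<Longrightarrow> n' \<in> carrier N \<Longrightarrow>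
      P (frag_of (m, n \<oplus>\<^bsub>N\<^esub> n') - (frag_of (m, n) + frag_of (m, n')))"
    and scale: "\<And>r m n. r \<in> carrier R \<Longrightarrow> m \<in> carrier M \<Longrightarrow> n \<in> carrier N \<Longrightarrow>
      P (frag_of (r \<odot>\<^bsub>M\<^esub> m, n) - frag_of (m, r \<odot>\<^bsub>N\<^esub> n))"
  shows "P c"
  using assms(1) unfolding tensor_relations_def
proof induction
  case one
  then show ?case using zero by simp
next
  case (incl c)
  then show ?case by (elim UnE CollectE exE conjE) (simp_all add: add_l add_r scale)
next
  case (inv c)
  then have c: "c \<in> tensor_relations R M N"
    unfolding tensor_relations_def by (rule generate.incl)
  have "P c"
    using inv by (elim UnE CollectE exE conjE) (simp_all add: add_l add_r scale)
  then have "P (- c)"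
    by (rule minus[OF c])
  then show ?case
    using subsetD[OF subgroup.subset[OF subgroup_tensor_relations] c] by simp
next
  case (eng c d)
  then show ?case using plus unfolding tensor_relations_def by simp
qed

text \<open>The universal property. A biadditive balanced map extends to the free abelian group, the
  extension kills the relations, and so it factors through the quotient. This is the only means of
  deducing an equation outside the tensor product from an equality of tensors.\<close>

lemma tensor_lift:
  fixes P :: "('p, 'q) ring_scheme"
  assumes P: "abelian_group P"
    and closed: "\<And>m n. m \<in> carrier M \<Longrightarrow> n \<in> carrier N \<Longrightarrow> \<beta> m n \<in> carrier P"
    and add_l: "\<And>m m' n. m \<in> carrier M \<Longrightarrow> m' \<in> carrier M \<Longrightarrow> n \<in> carrier N \<Longrightarrow>
      \<beta> (m \<oplus>\<^bsub>M\<^esub> m') n = \<beta> m n \<oplus>\<^bsub>P\<^esub> \<beta> m' n"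
    and add_r: "\<And>m n n'. m \<in> carrier M \<Longrightarrow> n \<in> carrier N \<Longrightarrow> n' \<in> carrier N \<Longrightarrow>
      \<beta> m (n \<oplus>\<^bsub>N\<^esub> n') = \<beta> m n \<oplus>\<^bsub>P\<^esub> \<beta> m n'"
    and bal: "\<And>r m n. r \<in> carrier R \<Longrightarrow> m \<in> carrier M \<Longrightarrow> n \<in> carrier N \<Longrightarrow>
      \<beta> (r \<odot>\<^bsub>M\<^esub> m) n = \<beta> m (r \<odot>\<^bsub>N\<^esub> n)"
  obtains g where "g \<in> hom (add_monoid (tensor_module R M N)) (add_monoid P)"
    and "\<And>m n. m \<in> carrier M \<Longrightarrow> n \<in> carrier N \<Longrightarrow> g (pure_tensor R M N m n) = \<beta> m n"
proof -
  interpret P: abelian_group P by fact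
  let ?F = "free_pairs M N"
  obtain h where h: "h \<in> hom ?F (add_monoid P)"
    and h_of: "\<And>x. x \<in> carrier M \<times> carrier N \<Longrightarrow> h (frag_of x) = (\<lambda>(m, n). \<beta> m n) x"
  proof (rule comm_group.free_Abelian_group_universal[OF P.a_comm_group])
    show "(\<lambda>(m, n). \<beta> m n) ` (carrier M \<times> carrier N) \<subseteq> carrier (add_monoid P)"
      using closed by auto
  qed (rule that)
  have h_closed: "h c \<in> carrier P" if "c \<in> carrier ?F" for c
    using hom_in_carrier[OF h that] by simp
  have h_add: "h (c + d) = h c \<oplus>\<^bsub>P\<^esub> h d" if "c \<in> carrier ?F" "d \<in> carrier ?F" for c d
    using hom_mult[OF h that] by simp
  have h_zero: "h 0 = \<zero>\<^bsub>P\<^esub>"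
    using hom_one[OF h] P.a_group by simp
  have h_eq: "h c = h d" if "c - d \<in> carrier ?F" "d \<in> carrier ?F" "h (c - d) = \<zero>\<^bsub>P\<^esub>" for c d
    using h_add[OF that(1,2)] that(2,3) h_closed by simp
  have h_diff: "h (c - d) = \<zero>\<^bsub>P\<^esub>"
    if "h c = h d" "c \<in> carrier ?F" "d \<in> carrier ?F" for c d
  proof -
    have cd: "c - d \<in> carrier ?F"
      using that(2,3) keys_diff[of c d] by auto
    have "h (c - d) \<oplus>\<^bsub>P\<^esub> h d = \<zero>\<^bsub>P\<^esub> \<oplus>\<^bsub>P\<^esub> h d"
      using h_add[OF cd that(3)] that h_closed by simp
    then show ?thesis
      using P.add.right_cancel h_closed cd that by (metis P.zero_closed)
  qed
  have plus: "c + d \<in> carrier ?F" if "c \<in> carrier ?F" "d \<in> carrier ?F" for c d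
    using that keys_add[of c d] by auto
  have h_rel: "h c = \<zero>\<^bsub>P\<^esub>" if "c \<in> tensor_relations R M N" for c
    using that
  proof (induction rule: tensor_relations_induct)
    case zero
    then show ?case using h_zero .
  next
    case (plus c d)
    then show ?case
      using h_add[of c d] subsetD[OF subgroup.subset[OF subgroup_tensor_relations]] by simp
  next
    case (minus c)
    have "h (0 - c) = \<zero>\<^bsub>P\<^esub>"
      using minus h_zero subsetD[OF subgroup.subset[OF subgroup_tensor_relations]] by (intro h_diff) auto
    then show ?case by simp
  next
    case (add_l m m' n)
    then have "frag_of (m, n) \<in> carrier ?F" "frag_of (m', n) \<in> carrier ?F" by auto
    from plus[OF this] h_add[OF this] add_l show ?case
      by (intro h_diff) (auto simp: h_of assms)
  next
    case (add_r m n n')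
    then have "frag_of (m, n) \<in> carrier ?F" "frag_of (m, n') \<in> carrier ?F" by auto
    from plus[OF this] h_add[OF this] add_r show ?case
      by (intro h_diff) (auto simp: h_of assms)
  next
    case (scale r m n)
    then show ?case
      by (intro h_diff) (auto simp: h_of bal)
  qed
  obtain g where g: "g \<in> hom (?F Mod tensor_relations R M N) (add_monoid P)"
    and g_coset: "\<And>x. x \<in> carrier ?F \<Longrightarrow> g (tensor_relations R M N #>\<^bsub>?F\<^esub> x) = h x"
  proof (rule FactGroup_universal[OF h normal_tensor_relations])
    fix c d assume "c \<in> carrier ?F" "d \<in> carrier ?F"
      "tensor_relations R M N #>\<^bsub>?F\<^esub> c = tensor_relations R M N #>\<^bsub>?F\<^esub> d"
    then have "c - d \<in> tensor_relations R M N"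
      using coset_eq_iff by blast
    moreover from this have "c - d \<in> carrier ?F"
      using subgroup.subset[OF subgroup_tensor_relations] by blast
    ultimately show "h c = h d"
      using h_rel h_eq \<open>d \<in> carrier ?F\<close> by blast
  qed (rule that)
  show ?thesis
  proof
    show "g \<in> hom (add_monoid (tensor_module R M N)) (add_monoid P)"
      using g by (simp add: hom_def tensor_module_def Let_def)
    show "g (pure_tensor R M N m n) = \<beta> m n" if "m \<in> carrier M" "n \<in> carrier N" for m n
      using that by (simp add: pure_tensor_def g_coset h_of)
  qed
qed

lemma zero_tensor_module: "\<zero>\<^bsub>tensor_module R M N\<^esub> = tensor_relations R M N #>\<^bsub>free_pairs M N\<^esub> 0"
  by (simp add: tensor_module_def Let_def r_coset_def)

lemma pure_tensor_add:
  assumes "m \<in> carrier M" "m' \<in> carrier M" "n \<in> carrier N"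
  shows "pure_tensor R M N (m \<oplus>\<^bsub>M\<^esub> m') n = pure_tensor R M N m n \<oplus>\<^bsub>tensor_module R M N\<^esub> pure_tensor R M N m' n"
proof -
  have m: "frag_of (m, n) \<in> carrier (free_pairs M N)" "frag_of (m', n) \<in> carrier (free_pairs M N)"
    using assms by auto
  have mm: "frag_of (m \<oplus>\<^bsub>M\<^esub> m', n) \<in> carrier (free_pairs M N)"
    using assms by auto
  have "frag_of (m, n) + frag_of (m', n) \<in> carrier (free_pairs M N)"
    using m keys_add[of "frag_of (m, n)" "frag_of (m', n)"] by auto
  moreover have "frag_of (m \<oplus>\<^bsub>M\<^esub> m', n) - (frag_of (m, n) + frag_of (m', n)) \<in> tensor_relations R M N"
    unfolding tensor_relations_def by (rule generate.incl) (use assms in blast)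
  ultimately show ?thesis
    unfolding pure_tensor_def coset_add[OF m] by (subst coset_eq_iff) (use mm in auto)
qed

lemma minus_pure_tensor:
  assumes "m \<in> carrier M" "n \<in> carrier N"
  shows "pure_tensor R M N (\<ominus>\<^bsub>M\<^esub> m) n = \<ominus>\<^bsub>tensor_module R M N\<^esub> pure_tensor R M N m n"
proof -
  interpret T: abelian_group "tensor_module R M N"
    by (rule abelian_group_tensor_module)
  have "(\<lambda>m. pure_tensor R M N m n) \<in> hom (add_monoid M) (add_monoid (tensor_module R M N))"
    using assms(2) by (auto simp: hom_def pure_tensor_closed pure_tensor_add)
  from hom_one[OF this] have "pure_tensor R M N \<zero>\<^bsub>M\<^esub> n = \<zero>\<^bsub>tensor_module R M N\<^esub>"
    using T.a_group M.a_group by simp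
  then have "pure_tensor R M N (\<ominus>\<^bsub>M\<^esub> m) n \<oplus>\<^bsub>tensor_module R M N\<^esub> pure_tensor R M N m n = \<zero>\<^bsub>tensor_module R M N\<^esub>"
    using assms by (simp flip: pure_tensor_add add: M.l_neg)
  then show ?thesis
    using T.minus_equality assms by (metis M.a_inv_closed pure_tensor_closed)
qed

text \<open>The sums of pure tensors form a subgroup, because a minus sign can be absorbed into a
  first factor, and the cosets of the free generators lie in it. This gives every section of the
  tensor presheaf an explicit form.\<close>

lemma tensor_eq_finsum_pure:
  assumes "t \<in> carrier (tensor_module R M N)"
  obtains n :: nat and m a where "\<And>k. k < n \<Longrightarrow> m k \<in> carrier M" "\<And>k. k < n \<Longrightarrow> a k \<in> carrier N"
    "t = (\<Oplus>\<^bsub>tensor_module R M N\<^esub>k\<in>{..<n}. pure_tensor R M N (m k) (a k))"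
proof -
  interpret T: abelian_group "tensor_module R M N"
    by (rule abelian_group_tensor_module)
  define S where "S = {\<Oplus>\<^bsub>tensor_module R M N\<^esub>k\<in>{..<n}. pure_tensor R M N (m k) (a k) |(n::nat) m a.
      \<forall>k<n. m k \<in> carrier M \<and> a k \<in> carrier N}"
  have S_subset: "S \<subseteq> carrier (tensor_module R M N)"
    unfolding S_def by (auto intro!: T.finsum_closed simp: pure_tensor_closed)
  have S_pure: "pure_tensor R M N m a \<in> S" if "m \<in> carrier M" "a \<in> carrier N" for m a
    unfolding S_def using that pure_tensor_closed[OF that]
    by (intro CollectI exI[of _ 1] exI[of _ "\<lambda>_. m"] exI[of _ "\<lambda>_. a"]) (simp add: lessThan_Suc)
  have S_zero: "\<zero>\<^bsub>tensor_module R M N\<^esub> \<in> S"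
    unfolding S_def by (intro CollectI exI[of _ 0]) simp
  have S_diff: "s \<oplus>\<^bsub>tensor_module R M N\<^esub> \<ominus>\<^bsub>tensor_module R M N\<^esub> u \<in> S" if "s \<in> S" "u \<in> S" for s u
  proof -
    obtain n :: nat and m a where s: "s = (\<Oplus>\<^bsub>tensor_module R M N\<^esub>k\<in>{..<n}. pure_tensor R M N (m k) (a k))"
      and ma: "\<forall>k<n. m k \<in> carrier M \<and> a k \<in> carrier N"
      using \<open>s \<in> S\<close> unfolding S_def by auto
    obtain p :: nat and l b where u: "u = (\<Oplus>\<^bsub>tensor_module R M N\<^esub>k\<in>{..<p}. pure_tensor R M N (l k) (b k))"
      and lb: "\<forall>k<p. l k \<in> carrier M \<and> b k \<in> carrier N"
      using \<open>u \<in> S\<close> unfolding S_def by auto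
    \<comment> \<open>The terms of \<open>s\<close> followed by those of \<open>u\<close>, the sign
      being carried by the first factor; the shift by \<open>n\<close> realigns the indices of the
      second block.\<close>
    let ?m = "\<lambda>k. if k < n then m k else \<ominus>\<^bsub>M\<^esub> l (k - n)" and ?a = "\<lambda>k. if k < n then a k else b (k - n)"
    \<comment> \<open>Membership in the carriers on both blocks.\<close>
    have mem: "?m k \<in> carrier M \<and> ?a k \<in> carrier N" if "k < n + p" for k
      using that ma lb by auto
    have "(\<Oplus>\<^bsub>tensor_module R M N\<^esub>k\<in>{..<n + q}. pure_tensor R M N (?m k) (?a k)) = s \<oplus>\<^bsub>tensor_module R M N\<^esub>
        \<ominus>\<^bsub>tensor_module R M N\<^esub> (\<Oplus>\<^bsub>tensor_module R M N\<^esub>k\<in>{..<q}. pure_tensor R M N (l k) (b k))" if "q \<le> p" for q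
      using that
    proof (induction q)
      case 0
      have "(\<Oplus>\<^bsub>tensor_module R M N\<^esub>k\<in>{..<n}. pure_tensor R M N (?m k) (?a k)) = s"
        unfolding s using ma by (intro T.finsum_cong') (auto simp: pure_tensor_closed)
      moreover have "\<ominus>\<^bsub>tensor_module R M N\<^esub> \<zero>\<^bsub>tensor_module R M N\<^esub> = \<zero>\<^bsub>tensor_module R M N\<^esub>"
        using T.r_neg[OF T.zero_closed] T.l_zero[OF T.a_inv_closed[OF T.zero_closed]] by simp
      ultimately show ?case
        using subsetD[OF S_subset \<open>s \<in> S\<close>] by simp
    next
      case (Suc q)
      let ?u = "\<Oplus>\<^bsub>tensor_module R M N\<^esub>k\<in>{..<q}. pure_tensor R M N (l k) (b k)"
      have p: "pure_tensor R M N (l q) (b q) \<in> carrier (tensor_module R M N)"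
        using Suc.prems lb by (auto simp: pure_tensor_closed)
      have u: "?u \<in> carrier (tensor_module R M N)"
        using Suc.prems lb by (auto intro!: T.finsum_closed simp: pure_tensor_closed)
      have sT: "s \<in> carrier (tensor_module R M N)"
        using \<open>s \<in> S\<close> S_subset by auto
      have "(\<Oplus>\<^bsub>tensor_module R M N\<^esub>k\<in>{..<n + Suc q}. pure_tensor R M N (?m k) (?a k))
          = pure_tensor R M N (?m (n + q)) (?a (n + q)) \<oplus>\<^bsub>tensor_module R M N\<^esub>
            (\<Oplus>\<^bsub>tensor_module R M N\<^esub>k\<in>{..<n + q}. pure_tensor R M N (?m k) (?a k))"
        unfolding add_Suc_right lessThan_Suc
        using ma lb Suc.prems by (intro T.finsum_insert) (auto intro!: pure_tensor_closed)
      also have "\<dots> = (\<ominus>\<^bsub>tensor_module R M N\<^esub> pure_tensor R M N (l q) (b q)) \<oplus>\<^bsub>tensor_module R M N\<^esub>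
          (s \<oplus>\<^bsub>tensor_module R M N\<^esub> \<ominus>\<^bsub>tensor_module R M N\<^esub> ?u)"
        using Suc lb by (simp add: minus_pure_tensor)
      also have "\<dots> = s \<oplus>\<^bsub>tensor_module R M N\<^esub>
          \<ominus>\<^bsub>tensor_module R M N\<^esub> (pure_tensor R M N (l q) (b q) \<oplus>\<^bsub>tensor_module R M N\<^esub> ?u)"
        using p u sT by (simp add: T.minus_add T.a_ac)
      also have "pure_tensor R M N (l q) (b q) \<oplus>\<^bsub>tensor_module R M N\<^esub> ?u
          = (\<Oplus>\<^bsub>tensor_module R M N\<^esub>k\<in>{..<Suc q}. pure_tensor R M N (l k) (b k))"
        unfolding lessThan_Suc
        using Suc.prems lb by (intro T.finsum_insert[symmetric]) (auto simp: pure_tensor_closed)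
      finally show ?case .
    qed
    from this[OF order_refl] have "s \<oplus>\<^bsub>tensor_module R M N\<^esub> \<ominus>\<^bsub>tensor_module R M N\<^esub> u
        = (\<Oplus>\<^bsub>tensor_module R M N\<^esub>k\<in>{..<n + p}. pure_tensor R M N (?m k) (?a k))"
      unfolding u by (rule sym)
    then show ?thesis
      unfolding S_def
      by (intro CollectI exI[of _ "n + p"] exI[of _ ?m] exI[of _ ?a] conjI) (use mem in blast)+
  qed
  obtain c where c: "Poly_Mapping.keys c \<subseteq> carrier M \<times> carrier N"
    and t: "t = tensor_relations R M N #>\<^bsub>free_pairs M N\<^esub> c"
    using assms by (auto simp: carrier_tensor_module)
  \<comment> \<open>\<open>frag_induction\<close> builds elements by differences, which is why
    \<open>S\<close> was shown to be closed under them. The bound on the keys is carried along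
    because the difference case needs representatives in the free group.\<close>
  have "tensor_relations R M N #>\<^bsub>free_pairs M N\<^esub> c \<in> S \<and> Poly_Mapping.keys c \<subseteq> carrier M \<times> carrier N"
    using c
  proof (induction rule: frag_induction)
    case zero
    then show ?case using S_zero by (simp add: zero_tensor_module)
  next
    case (diff c d)
    have cd: "c - d \<in> carrier (free_pairs M N)"
      using diff keys_diff[of c d] by auto
    \<comment> \<open>\<open>coset_add\<close> speaks of sums only, so it is applied to
      \<open>(c - d) + d\<close> and then solved for the coset of \<open>c - d\<close>.\<close>
    have "(tensor_relations R M N #>\<^bsub>free_pairs M N\<^esub> (c - d)) \<oplus>\<^bsub>tensor_module R M N\<^esub>
        (tensor_relations R M N #>\<^bsub>free_pairs M N\<^esub> d) = tensor_relations R M N #>\<^bsub>free_pairs M N\<^esub> c"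
      using coset_add[OF cd, of d] diff by simp
    moreover have "tensor_relations R M N #>\<^bsub>free_pairs M N\<^esub> d \<in> carrier (tensor_module R M N)"
      "tensor_relations R M N #>\<^bsub>free_pairs M N\<^esub> (c - d) \<in> carrier (tensor_module R M N)"
      using diff cd by (auto simp: carrier_tensor_module)
    ultimately have "tensor_relations R M N #>\<^bsub>free_pairs M N\<^esub> (c - d) =
        (tensor_relations R M N #>\<^bsub>free_pairs M N\<^esub> c) \<oplus>\<^bsub>tensor_module R M N\<^esub>
        \<ominus>\<^bsub>tensor_module R M N\<^esub> (tensor_relations R M N #>\<^bsub>free_pairs M N\<^esub> d)"
      by (metis T.a_inv_closed T.a_assoc T.r_neg T.r_zero)
    then show ?case
      using S_diff diff cd by simp
  next
    case (one x)
    then show ?case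
      using S_pure[of "fst x" "snd x"] by (auto simp: pure_tensor_def)
  qed
  then obtain n :: nat and m a where
    "tensor_relations R M N #>\<^bsub>free_pairs M N\<^esub> c =
      (\<Oplus>\<^bsub>tensor_module R M N\<^esub>k\<in>{..<n}. pure_tensor R M N (m k) (a k))"
    "\<forall>k<n. m k \<in> carrier M \<and> a k \<in> carrier N"
    unfolding S_def by blast
  then show thesis
    using that[of n m a] t by simp
qed

lemma tensor_sum_closed:
  assumes "\<And>k. k < (n::nat) \<Longrightarrow> m k \<in> carrier M" "\<And>k. k < n \<Longrightarrow> a k \<in> carrier N"
  shows "(\<Oplus>\<^bsub>tensor_module R M N\<^esub>k\<in>{..<n}. pure_tensor R M N (m k) (a k)) \<in> carrier (tensor_module R M N)"
proof -
  interpret T: abelian_group "tensor_module R M N"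
    by (rule abelian_group_tensor_module)
  show ?thesis
    using assms by (intro T.finsum_closed) (auto simp: pure_tensor_closed)
qed

end

section \<open>Maps between tensor products\<close>

text \<open>The change of rings \<open>\<rho>\<close> lets one locale cover two cases: the
  restriction maps of a tensor presheaf, where \<open>\<rho>\<close> restricts functions, and \<phi>
  \<otimes> id over a fixed open set, where \<open>\<rho>\<close> is the identity.\<close>

locale tensor_hom = source: two_modules R M N + target: two_modules R' M' N'
  for R :: "'r ring" and M :: "('r, 'a) module" and N :: "('r, 'b) module"
    and R' :: "'s ring" and M' :: "('s, 'c) module" and N' :: "('s, 'd) module" +
  fixes \<rho> :: "'r \<Rightarrow> 's" and h :: "'a \<Rightarrow> 'c" and k :: "'b \<Rightarrow> 'd"
  assumes rho: "\<rho> \<in> carrier R \<rightarrow> carrier R'"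
    and h_hom: "h \<in> hom (add_monoid M) (add_monoid M')"
    and k_hom: "k \<in> hom (add_monoid N) (add_monoid N')"
    and h_smult: "r \<in> carrier R \<Longrightarrow> m \<in> carrier M \<Longrightarrow> h (r \<odot>\<^bsub>M\<^esub> m) = \<rho> r \<odot>\<^bsub>M'\<^esub> h m"
    and k_smult: "r \<in> carrier R \<Longrightarrow> n \<in> carrier N \<Longrightarrow> k (r \<odot>\<^bsub>N\<^esub> n) = \<rho> r \<odot>\<^bsub>N'\<^esub> k n"
begin

lemma h_add: "m \<in> carrier M \<Longrightarrow> m' \<in> carrier M \<Longrightarrow> h (m \<oplus>\<^bsub>M\<^esub> m') = h m \<oplus>\<^bsub>M'\<^esub> h m'"
  and h_closed: "m \<in> carrier M \<Longrightarrow> h m \<in> carrier M'"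
  using h_hom by (auto simp: hom_def)

lemma k_add: "n \<in> carrier N \<Longrightarrow> n' \<in> carrier N \<Longrightarrow> k (n \<oplus>\<^bsub>N\<^esub> n') = k n \<oplus>\<^bsub>N'\<^esub> k n'"
  and k_closed: "n \<in> carrier N \<Longrightarrow> k n \<in> carrier N'"
  using k_hom by (auto simp: hom_def)

lemma frag_extend_closed:
  assumes "c \<in> carrier (free_pairs M N)"
  shows "frag_extend (\<lambda>(m, n). frag_of (h m, k n)) c \<in> carrier (free_pairs M' N')"
  using assms[unfolded carrier_free_Abelian_group_iff]
proof (induction rule: frag_induction)
  case (diff c d)
  then show ?case
    using keys_diff[of "frag_extend (\<lambda>(m, n). frag_of (h m, k n)) c" "frag_extend (\<lambda>(m, n). frag_of (h m, k n)) d"]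
    by (auto simp: frag_extend_diff)
qed (auto simp: h_closed k_closed)

lemma frag_extend_relations:
  assumes "c \<in> tensor_relations R M N"
  shows "frag_extend (\<lambda>(m, n). frag_of (h m, k n)) c \<in> tensor_relations R' M' N'"
  using assms
proof (induction rule: source.tensor_relations_induct)
  case zero
  show ?case
    using subgroup.one_closed[OF target.subgroup_tensor_relations] by simp
next
  case (plus c d)
  then show ?case
    by (simp add: frag_extend_add target.tensor_relations_closed)
next
  case (minus c)
  then show ?case
    by (simp add: frag_extend_minus target.tensor_relations_closed)
next
  case (add_l m m' n)
  then show ?case
    unfolding tensor_relations_def frag_extend_add frag_extend_diff
    by (intro generate.incl) (simp add: h_add, use h_closed k_closed in blast)
next
  case (add_r m n n')
  then show ?case
    unfolding tensor_relations_def frag_extend_add frag_extend_diff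
    by (intro generate.incl) (simp add: k_add, use h_closed k_closed in blast)
next
  case (scale r m n)
  then show ?case
    unfolding tensor_relations_def frag_extend_diff
    by (intro generate.incl) (simp add: h_smult k_smult, use h_closed k_closed rho in blast)
qed

text \<open>The union in \<open>tensor_map\<close> collapses: representatives of one coset differ by
  relations, relations go to relations, and so all members of the union are the same coset. As the
  set of relations is nonempty, the union is that coset and not the empty set.\<close>

lemma tensor_map_coset:
  assumes "c \<in> carrier (free_pairs M N)"
  shows "tensor_map R' M' N' h k (tensor_relations R M N #>\<^bsub>free_pairs M N\<^esub> c) =
    tensor_relations R' M' N' #>\<^bsub>free_pairs M' N'\<^esub> frag_extend (\<lambda>(m, n). frag_of (h m, k n)) c"
proof -
  have "tensor_relations R' M' N' #>\<^bsub>free_pairs M' N'\<^esub> frag_extend (\<lambda>(m, n). frag_of (h m, k n)) (r + c) =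
    tensor_relations R' M' N' #>\<^bsub>free_pairs M' N'\<^esub> frag_extend (\<lambda>(m, n). frag_of (h m, k n)) c"
    if "r \<in> tensor_relations R M N" for r
  proof -
    have "r + c \<in> carrier (free_pairs M N)"
      using assms subsetD[OF subgroup.subset[OF source.subgroup_tensor_relations] that] keys_add[of r c] by auto
    then have "frag_extend (\<lambda>(m, n). frag_of (h m, k n)) (r + c) \<in> carrier (free_pairs M' N')"
      by (rule frag_extend_closed)
    then show ?thesis
      using frag_extend_relations[OF that]
      by (subst target.coset_eq_iff) (simp_all add: frag_extend_closed assms frag_extend_add del: carrier_free_Abelian_group_iff)
  qed
  moreover have "tensor_relations R M N \<noteq> {}"
    using subgroup.one_closed[OF source.subgroup_tensor_relations] by auto
  ultimately show ?thesis
    unfolding tensor_map_def r_coset_def[of "free_pairs M N"] by auto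
qed

lemma tensor_map_hom:
  "tensor_map R' M' N' h k \<in> hom (add_monoid (tensor_module R M N)) (add_monoid (tensor_module R' M' N'))"
proof (rule homI)
  fix s t assume "s \<in> carrier (add_monoid (tensor_module R M N))" "t \<in> carrier (add_monoid (tensor_module R M N))"
  then obtain c d where c: "c \<in> carrier (free_pairs M N)" "s = tensor_relations R M N #>\<^bsub>free_pairs M N\<^esub> c"
    and d: "d \<in> carrier (free_pairs M N)" "t = tensor_relations R M N #>\<^bsub>free_pairs M N\<^esub> d"
    by (auto simp: source.carrier_tensor_module)
  have "c + d \<in> carrier (free_pairs M N)"
    using c(1) d(1) keys_add[of c d] by auto
  then show "tensor_map R' M' N' h k (s \<otimes>\<^bsub>add_monoid (tensor_module R M N)\<^esub> t) =
      tensor_map R' M' N' h k s \<otimes>\<^bsub>add_monoid (tensor_module R' M' N')\<^esub> tensor_map R' M' N' h k t"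
    using c d by (simp add: source.coset_add tensor_map_coset target.coset_add frag_extend_closed frag_extend_add
      del: carrier_free_Abelian_group_iff)
qed (auto simp: source.carrier_tensor_module target.carrier_tensor_module tensor_map_coset
    simp del: carrier_free_Abelian_group_iff intro!: imageI frag_extend_closed)

lemma tensor_map_pure:
  assumes "m \<in> carrier M" "n \<in> carrier N"
  shows "tensor_map R' M' N' h k (pure_tensor R M N m n) = pure_tensor R' M' N' (h m) (k n)"
  using assms unfolding pure_tensor_def by (subst tensor_map_coset) auto

lemma tensor_map_sum:
  assumes "\<And>i. i < (n::nat) \<Longrightarrow> m i \<in> carrier M" "\<And>i. i < n \<Longrightarrow> a i \<in> carrier N"
  shows "tensor_map R' M' N' h k (\<Oplus>\<^bsub>tensor_module R M N\<^esub>i\<in>{..<n}. pure_tensor R M N (m i) (a i)) =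
    (\<Oplus>\<^bsub>tensor_module R' M' N'\<^esub>i\<in>{..<n}. pure_tensor R' M' N' (h (m i)) (k (a i)))"
proof -
  interpret T': abelian_group "tensor_module R' M' N'"
    by (rule target.abelian_group_tensor_module)
  show ?thesis
    using assms hom_finsum[OF source.abelian_group_tensor_module target.abelian_group_tensor_module tensor_map_hom,
        of n "\<lambda>i. pure_tensor R M N (m i) (a i)"]
    by (simp add: source.pure_tensor_closed)
       (intro T'.finsum_cong', auto simp: tensor_map_pure target.pure_tensor_closed h_closed k_closed)
qed

end

section \<open>Regular functions\<close>

text \<open>The nonvanishing set of the constant polynomial 1 is all of \<open>points\<close>, so
  the whole space is among the generating sets.\<close>

lemma topspace_zariski: "topspace zariski = points"
proof -
  have "homogeneous 0 (\<lambda>_. 1)"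
    by (rule homogeneous.const)
  then have "points \<in> {{p \<in> points. \<forall>v\<in>p. f v \<noteq> 0} |f. \<exists>d. homogeneous d f}"
    by (auto intro!: exI[of _ "\<lambda>_. 1"])
  then show ?thesis
    unfolding zariski_def topology_generated_by_topspace by blast
qed

lemma openin_zar: "openin (zar X) U \<longleftrightarrow> (\<exists>T. openin zariski T \<and> U = T \<inter> X)"
  by (simp add: zar_def openin_subtopology)

lemma openin_zar_points: "openin (zar X) U \<Longrightarrow> U \<subseteq> points"
  using openin_subset topspace_zariski by (force simp: openin_zar)

lemma openin_zar_subset: "openin (zar X) U \<Longrightarrow> U \<subseteq> X"
  by (auto simp: openin_zar)

lemma openin_zar_self: "X \<subseteq> points \<Longrightarrow> openin (zar X) X"
  using openin_topspace[of zariski] by (auto simp: openin_zar topspace_zariski)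

lemma openin_zar_Int_subset: "openin (zar U) W \<Longrightarrow> openin (zar (V \<inter> U)) (V \<inter> W)"
  by (auto simp: openin_zar)

lemma openin_zar_trans: "openin (zar U) V \<Longrightarrow> openin (zar V) W \<Longrightarrow> openin (zar U) W"
  by (auto simp: openin_zar)

lemma openin_zar_relative: "openin (zar X) V \<Longrightarrow> V \<subseteq> U \<Longrightarrow> U \<subseteq> X \<Longrightarrow> openin (zar U) V"
  by (auto simp: openin_zar)

lemma carrier_reg [simp]: "f \<in> carrier (reg U) \<longleftrightarrow> regular_on U f"
  by (simp add: reg_def)

lemma reg_ops [simp]:
  "f \<oplus>\<^bsub>reg U\<^esub> g = (\<lambda>x\<in>U. f x + g x)" "f \<otimes>\<^bsub>reg U\<^esub> g = (\<lambda>x\<in>U. f x * g x)"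
  "\<zero>\<^bsub>reg U\<^esub> = (\<lambda>x\<in>U. 0)" "\<one>\<^bsub>reg U\<^esub> = (\<lambda>x\<in>U. 1)"
  by (simp_all add: reg_def)

lemma regular_on_const: "U \<subseteq> points \<Longrightarrow> regular_on U (\<lambda>x\<in>U. c)"
  unfolding regular_on_def
proof (intro conjI ballI)
  fix x assume "U \<subseteq> points" "x \<in> U"
  then show "\<exists>W d a b. openin (zar U) W \<and> x \<in> W \<and> homogeneous d a \<and> homogeneous d b \<and>
      (\<forall>y\<in>W. \<forall>v\<in>y. b v \<noteq> 0 \<and> (\<lambda>x\<in>U. c) y = a v / b v)"
    by (intro exI[of _ U] exI[of _ 0] exI[of _ "\<lambda>_. c"] exI[of _ "\<lambda>_. 1"])
       (simp add: openin_zar_self homogeneous.const)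
qed simp

text \<open>Near a point both functions are fractions of forms, on possibly different
  neighbourhoods. Sums and products differ only in how two fractions combine into one whose
  numerator and denominator share a degree; this is left to the assumption on
  \<open>op\<close>.\<close>

lemma regular_on_binop:
  assumes f: "regular_on U f" and g: "regular_on U g"
    and op: "\<And>d a b e a' b'. homogeneous d a \<Longrightarrow> homogeneous d b \<Longrightarrow> homogeneous e a' \<Longrightarrow> homogeneous e b' \<Longrightarrow>
      \<exists>c p q. homogeneous c p \<and> homogeneous c q \<and>
        (\<forall>v. b v \<noteq> 0 \<and> b' v \<noteq> 0 \<longrightarrow> q v \<noteq> 0 \<and> op (a v / b v) (a' v / b' v) = p v / q v)"
  shows "regular_on U (\<lambda>x\<in>U. op (f x) (g x))"
  unfolding regular_on_def
proof (intro conjI ballI)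
  fix x assume x: "x \<in> U"
  obtain W d a b where W: "openin (zar U) W" "x \<in> W" "homogeneous d a" "homogeneous d b"
    "\<forall>y\<in>W. \<forall>v\<in>y. b v \<noteq> 0 \<and> f y = a v / b v"
    using f x unfolding regular_on_def by blast
  obtain W' e a' b' where W': "openin (zar U) W'" "x \<in> W'" "homogeneous e a'" "homogeneous e b'"
    "\<forall>y\<in>W'. \<forall>v\<in>y. b' v \<noteq> 0 \<and> g y = a' v / b' v"
    using g x unfolding regular_on_def by blast
  obtain c p q where "homogeneous c p" "homogeneous c q"
    "\<forall>v. b v \<noteq> 0 \<and> b' v \<noteq> 0 \<longrightarrow> q v \<noteq> 0 \<and> op (a v / b v) (a' v / b' v) = p v / q v"
    using op[OF W(3,4) W'(3,4)] by blast
  moreover have "openin (zar U) (W \<inter> W')"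
    using W(1) W'(1) by (rule openin_Int)
  moreover from this have "W \<inter> W' \<subseteq> U"
    by (rule openin_zar_subset)
  ultimately show "\<exists>W d a b. openin (zar U) W \<and> x \<in> W \<and> homogeneous d a \<and> homogeneous d b \<and>
      (\<forall>y\<in>W. \<forall>v\<in>y. b v \<noteq> 0 \<and> (\<lambda>x\<in>U. op (f x) (g x)) y = a v / b v)"
    using W(2,5) W'(2,5)
    by (intro exI[of _ "W \<inter> W'"] exI[of _ c] exI[of _ p] exI[of _ q]) (auto simp: subset_iff)
qed auto

lemma regular_on_mult:
  assumes "regular_on U f" "regular_on U g"
  shows "regular_on U (\<lambda>x\<in>U. f x * g x)"
proof (rule regular_on_binop[OF assms, of "(*)"])
  fix d a b e a' b'
  assume h: "homogeneous d a" "homogeneous d b" "homogeneous e a'" "homogeneous e b'"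
  show "\<exists>c p q. homogeneous c p \<and> homogeneous c q \<and>
        (\<forall>v. b v \<noteq> 0 \<and> b' v \<noteq> 0 \<longrightarrow> q v \<noteq> 0 \<and> (a v / b v) * (a' v / b' v) = p v / q v)"
    using homogeneous.mult[OF h(1,3)] homogeneous.mult[OF h(2,4)]
    by (intro exI[of _ "d + e"] exI[of _ "\<lambda>v. a v * a' v"] exI[of _ "\<lambda>v. b v * b' v"]) auto
qed

lemma regular_on_add:
  assumes "regular_on U f" "regular_on U g"
  shows "regular_on U (\<lambda>x\<in>U. f x + g x)"
proof (rule regular_on_binop[OF assms, of "(+)"])
  fix d a b e a' b'
  assume h: "homogeneous d a" "homogeneous d b" "homogeneous e a'" "homogeneous e b'"
  \<comment> \<open>Each product has its factor of degree \<open>d\<close> first, so that both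
    summands get literally the degree \<open>d + e\<close>, as \<open>homogeneous.add\<close>
    requires.\<close>
  have "homogeneous (d + e) (\<lambda>v. a v * b' v + b v * a' v)"
    by (intro homogeneous.add homogeneous.mult h)
  then show "\<exists>c p q. homogeneous c p \<and> homogeneous c q \<and>
        (\<forall>v. b v \<noteq> 0 \<and> b' v \<noteq> 0 \<longrightarrow> q v \<noteq> 0 \<and> (a v / b v) + (a' v / b' v) = p v / q v)"
    using homogeneous.mult[OF h(2,4)]
    by (intro exI[of _ "d + e"] exI[of _ "\<lambda>v. a v * b' v + b v * a' v"] exI[of _ "\<lambda>v. b v * b' v"])
       (auto simp: field_simps)
qed

lemma regular_on_restrict:
  assumes "regular_on U f" "V \<subseteq> U"
  shows "regular_on V (restrict f V)"
  unfolding regular_on_def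
proof (intro conjI ballI)
  fix x assume x: "x \<in> V"
  then obtain W d a b where W: "openin (zar U) W" "x \<in> W" "homogeneous d a" "homogeneous d b"
    "\<forall>y\<in>W. \<forall>v\<in>y. b v \<noteq> 0 \<and> f y = a v / b v"
    using assms unfolding regular_on_def by blast
  have "openin (zar V) (V \<inter> W)"
    using openin_zar_Int_subset[OF W(1), of V] assms(2) by (simp add: Int_absorb2)
  then show "\<exists>W d a b. openin (zar V) W \<and> x \<in> W \<and> homogeneous d a \<and> homogeneous d b \<and>
      (\<forall>y\<in>W. \<forall>v\<in>y. b v \<noteq> 0 \<and> restrict f V y = a v / b v)"
    using W(2-) x by (intro exI[of _ "V \<inter> W"] exI[of _ d] exI[of _ a] exI[of _ b]) auto
qed auto

text \<open>Wanted for \<open>pairing\<close>, whose chart changes from point to point, so that only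
  its restrictions to single charts are visibly regular.\<close>

lemma regular_on_local:
  assumes "f \<in> extensional U"
    and "\<And>x. x \<in> U \<Longrightarrow> \<exists>V. openin (zar U) V \<and> x \<in> V \<and> regular_on V (restrict f V)"
  shows "regular_on U f"
  unfolding regular_on_def
proof (intro conjI ballI)
  fix x assume "x \<in> U"
  then obtain V where V: "openin (zar U) V" "x \<in> V" "regular_on V (restrict f V)"
    using assms(2) by blast
  then obtain W d a b where W: "openin (zar V) W" "x \<in> W" "homogeneous d a" "homogeneous d b"
    "\<forall>y\<in>W. \<forall>v\<in>y. b v \<noteq> 0 \<and> restrict f V y = a v / b v"
    unfolding regular_on_def by blast
  have "W \<subseteq> V"
    using W(1) by (rule openin_zar_subset)
  then show "\<exists>W d a b. openin (zar U) W \<and> x \<in> W \<and> homogeneous d a \<and> homogeneous d b \<and>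
      (\<forall>y\<in>W. \<forall>v\<in>y. b v \<noteq> 0 \<and> f y = a v / b v)"
    using W openin_zar_trans[OF V(1) W(1)]
    by (intro exI[of _ W] exI[of _ d] exI[of _ a] exI[of _ b]) (auto simp: subset_iff)
qed fact

lemma regular_on_extensional: "regular_on U f \<Longrightarrow> f \<in> extensional U"
  by (simp add: regular_on_def)

lemma cring_reg:
  assumes U: "U \<subseteq> points"
  shows "cring (reg U)"
proof (intro cringI abelian_groupI comm_monoidI)
  fix f assume f: "f \<in> carrier (reg U)"
  have "regular_on U (\<lambda>x\<in>U. (\<lambda>x\<in>U. - 1) x * f x)"
    using f by (intro regular_on_mult regular_on_const U) simp
  then show "\<exists>g\<in>carrier (reg U). g \<oplus>\<^bsub>reg U\<^esub> f = \<zero>\<^bsub>reg U\<^esub>"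
    by (intro bexI[of _ "\<lambda>x\<in>U. (\<lambda>x\<in>U. - 1) x * f x"]) (auto simp: fun_eq_iff)
qed (auto simp: fun_eq_iff regular_on_add regular_on_mult regular_on_const U algebra_simps
    extensional_arb[OF regular_on_extensional])

section \<open>Sections of line bundles\<close>

lemma carrier_line_sheaf:
  "s \<in> carrier (sec (line_sheaf (U, g)) V) \<longleftrightarrow> (\<forall>i. regular_on (V \<inter> U i) (s i)) \<and>
     (\<forall>i j. \<forall>x\<in>V \<inter> U i \<inter> U j. s i x = g i j x * s j x)"
  by (simp add: line_sheaf_def)

lemma line_sheaf_ops:
  "s \<oplus>\<^bsub>sec (line_sheaf (U, g)) V\<^esub> t = (\<lambda>i. \<lambda>x\<in>V \<inter> U i. s i x + t i x)"
  "\<zero>\<^bsub>sec (line_sheaf (U, g)) V\<^esub> = (\<lambda>i. \<lambda>x\<in>V \<inter> U i. 0)"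
  "f \<odot>\<^bsub>sec (line_sheaf (U, g)) V\<^esub> s = (\<lambda>i. \<lambda>x\<in>V \<inter> U i. f x * s i x)"
  "res (line_sheaf (U, g)) V W s = (\<lambda>i. restrict (s i) (W \<inter> U i))"
  by (simp_all add: line_sheaf_def)

lemma line_sheaf_regular: "s \<in> carrier (sec (line_sheaf (U, g)) V) \<Longrightarrow> regular_on (V \<inter> U i) (s i)"
  unfolding carrier_line_sheaf by blast

lemma line_sheaf_transition:
  "s \<in> carrier (sec (line_sheaf (U, g)) V) \<Longrightarrow> x \<in> V \<Longrightarrow> x \<in> U i \<Longrightarrow> x \<in> U j \<Longrightarrow> s i x = g i j x * s j x"
  unfolding carrier_line_sheaf by blast

lemma line_sheafI:
  assumes "\<And>i. regular_on (V \<inter> U i) (s i)"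
    and "\<And>i j x. x \<in> V \<Longrightarrow> x \<in> U i \<Longrightarrow> x \<in> U j \<Longrightarrow> s i x = g i j x * s j x"
  shows "s \<in> carrier (sec (line_sheaf (U, g)) V)"
  unfolding carrier_line_sheaf using assms by blast

lemma line_sheaf_smult_closed:
  assumes "regular_on V f" "s \<in> carrier (sec (line_sheaf (U, g)) V)"
  shows "f \<odot>\<^bsub>sec (line_sheaf (U, g)) V\<^esub> s \<in> carrier (sec (line_sheaf (U, g)) V)"
proof (rule line_sheafI)
  fix i
  have "regular_on (V \<inter> U i) (\<lambda>x\<in>V \<inter> U i. restrict f (V \<inter> U i) x * s i x)"
    using assms by (intro regular_on_mult regular_on_restrict[of V] line_sheaf_regular) auto
  also have "(\<lambda>x\<in>V \<inter> U i. restrict f (V \<inter> U i) x * s i x) = (\<lambda>x\<in>V \<inter> U i. f x * s i x)"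
    by (auto simp: fun_eq_iff)
  finally show "regular_on (V \<inter> U i) ((f \<odot>\<^bsub>sec (line_sheaf (U, g)) V\<^esub> s) i)"
    by (simp only: line_sheaf_ops)
next
  fix i j x assume "x \<in> V" "x \<in> U i" "x \<in> U j"
  then show "(f \<odot>\<^bsub>sec (line_sheaf (U, g)) V\<^esub> s) i x = g i j x * (f \<odot>\<^bsub>sec (line_sheaf (U, g)) V\<^esub> s) j x"
    using line_sheaf_transition[OF assms(2), of x i j] by (simp add: line_sheaf_ops)
qed

lemma line_sheaf_module:
  assumes V: "V \<subseteq> points"
  shows "Module.module (reg V) (sec (line_sheaf L) V)"
proof (cases L)
  case (Pair U g)
  \<comment> \<open>The module laws are equalities of functions on the whole type, so the default
    value off \<open>V \<inter> U i\<close> has to match as well.\<close>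
  have ext: "s i x = undefined" if "s \<in> carrier (sec (line_sheaf (U, g)) V)" "x \<notin> V \<or> x \<notin> U i" for s i x
    using that regular_on_extensional[OF line_sheaf_regular[OF that(1), of i]] by (auto simp: extensional_def)
  have "Module.module (reg V) (sec (line_sheaf (U, g)) V)"
  proof (intro moduleI cring_reg V abelian_groupI)
    fix s t assume st: "s \<in> carrier (sec (line_sheaf (U, g)) V)" "t \<in> carrier (sec (line_sheaf (U, g)) V)"
    show "s \<oplus>\<^bsub>sec (line_sheaf (U, g)) V\<^esub> t \<in> carrier (sec (line_sheaf (U, g)) V)"
    proof (rule line_sheafI)
      fix i j x assume "x \<in> V" "x \<in> U i" "x \<in> U j"
      then show "(s \<oplus>\<^bsub>sec (line_sheaf (U, g)) V\<^esub> t) i x = g i j x * (s \<oplus>\<^bsub>sec (line_sheaf (U, g)) V\<^esub> t) j x"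
        using line_sheaf_transition[OF st(1), of x i j] line_sheaf_transition[OF st(2), of x i j]
        by (simp add: line_sheaf_ops algebra_simps)
    qed (simp add: line_sheaf_ops regular_on_add line_sheaf_regular[OF st(1)] line_sheaf_regular[OF st(2)])
  next
    fix s assume s: "s \<in> carrier (sec (line_sheaf (U, g)) V)"
    have "(\<lambda>x\<in>V. - 1) \<odot>\<^bsub>sec (line_sheaf (U, g)) V\<^esub> s \<in> carrier (sec (line_sheaf (U, g)) V)"
      by (rule line_sheaf_smult_closed[OF regular_on_const[OF V] s])
    then show "\<exists>t\<in>carrier (sec (line_sheaf (U, g)) V).
        t \<oplus>\<^bsub>sec (line_sheaf (U, g)) V\<^esub> s = \<zero>\<^bsub>sec (line_sheaf (U, g)) V\<^esub>"
      by (rule bexI[rotated]) (auto simp: line_sheaf_ops fun_eq_iff)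
  next
    show "\<zero>\<^bsub>sec (line_sheaf (U, g)) V\<^esub> \<in> carrier (sec (line_sheaf (U, g)) V)"
      using V by (intro line_sheafI) (auto simp: line_sheaf_ops intro!: regular_on_const)
  next
    fix f s assume "f \<in> carrier (reg V)" "s \<in> carrier (sec (line_sheaf (U, g)) V)"
    then show "f \<odot>\<^bsub>sec (line_sheaf (U, g)) V\<^esub> s \<in> carrier (sec (line_sheaf (U, g)) V)"
      by (simp add: line_sheaf_smult_closed)
  qed (auto simp: line_sheaf_ops fun_eq_iff algebra_simps ext)
  then show ?thesis using Pair by simp
qed

lemma line_sheaf_module_presheaf: "module_presheaf X (line_sheaf L)"
proof (cases L)
  case (Pair U g)
  have "module_presheaf X (line_sheaf (U, g))"
    unfolding module_presheaf_def
  proof (intro conjI allI impI ballI, goal_cases)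
    case (1 V)
    then show ?case by (intro line_sheaf_module openin_zar_points)
  next
    case (2 V W)
    show ?case
    proof
      fix s assume s: "s \<in> carrier (sec (line_sheaf (U, g)) V)"
      show "res (line_sheaf (U, g)) V W s \<in> carrier (sec (line_sheaf (U, g)) W)"
      proof (rule line_sheafI)
        show "regular_on (W \<inter> U i) (res (line_sheaf (U, g)) V W s i)" for i
          unfolding line_sheaf_ops
          using 2 by (intro regular_on_restrict[of "V \<inter> U i"] line_sheaf_regular[OF s]) auto
        show "res (line_sheaf (U, g)) V W s i x = g i j x * res (line_sheaf (U, g)) V W s j x"
          if "x \<in> W" "x \<in> U i" "x \<in> U j" for i j x
          using line_sheaf_transition[OF s, of x i j] that 2 by (auto simp: line_sheaf_ops)
      qed
    qed
  next
    case (5 V s)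
    have "s i x = undefined" if "x \<notin> V \<or> x \<notin> U i" for i x
      using that regular_on_extensional[OF line_sheaf_regular[OF 5(2), of i]] by (auto simp: extensional_def)
    then show ?case by (intro ext) (auto simp: line_sheaf_ops)
  qed (auto simp: line_sheaf_ops fun_eq_iff)
  then show ?thesis using Pair by simp
qed

section \<open>The pairing of a line bundle with its dual\<close>

context
  fixes X L U g
  assumes lb: "line_bundle X L" and L: "L = (U, g)"
begin

text \<open>Independence of the chart: the transition functions of the bundle and of its dual are
  inverse to each other and cancel in the product. The least index in \<open>pairing\<close> may
  thus be replaced by any chart containing \<open>x\<close>.\<close>

lemma pairing_eq:
  assumes V: "openin (zar X) V" and l: "l \<in> carrier (sec (line_sheaf (dual_bundle L)) V)"
    and a: "a \<in> carrier (sec (line_sheaf L) V)"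
    and x: "x \<in> V" "x \<in> U i"
  shows "pairing L V l a x = l i x * a i x"
proof -
  define j where "j = (LEAST j. x \<in> U j)"
  have j: "x \<in> U j"
    unfolding j_def by (rule LeastI[of _ i]) fact
  have "g j i x \<noteq> 0"
    using lb x j by (auto simp: L line_bundle_def)
  moreover have "l j x = inverse (g j i x) * l i x"
    using line_sheaf_transition[OF l[unfolded dual_bundle_def L prod.case] x(1) j x(2)] x j by simp
  moreover have "a j x = g j i x * a i x"
    using line_sheaf_transition[OF a[unfolded L] x(1) j x(2)] .
  ultimately show ?thesis
    using x by (simp add: pairing_def L Let_def flip: j_def)
qed

text \<open>The least index is not constant on \<open>V\<close>, so regularity is checked on each
  \<open>V \<inter> U i\<close>, where by \<open>pairing_eq\<close> a single product of regular
  functions computes the pairing.\<close>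

lemma pairing_regular:
  assumes V: "openin (zar X) V" and l: "l \<in> carrier (sec (line_sheaf (dual_bundle L)) V)"
    and a: "a \<in> carrier (sec (line_sheaf L) V)"
  shows "regular_on V (pairing L V l a)"
proof (rule regular_on_local)
  fix x assume x: "x \<in> V"
  then have "x \<in> X"
    using openin_zar_subset[OF V] by auto
  then obtain i where i: "x \<in> U i"
    using lb by (auto simp: L line_bundle_def)
  have "openin (zar X) (V \<inter> U i)"
    using lb V by (intro openin_Int) (auto simp: L line_bundle_def)
  then have "openin (zar V) (V \<inter> U i)"
    by (rule openin_zar_relative) (use openin_zar_subset[OF V] in auto)
  moreover have "regular_on (V \<inter> U i) (\<lambda>x\<in>V \<inter> U i. l i x * a i x)"
    using line_sheaf_regular[OF l[unfolded dual_bundle_def L prod.case]] line_sheaf_regular[OF a[unfolded L]]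
    by (intro regular_on_mult)
  moreover have "(\<lambda>x\<in>V \<inter> U i. l i x * a i x) = restrict (pairing L V l a) (V \<inter> U i)"
    using pairing_eq[OF assms] by (auto simp: fun_eq_iff)
  ultimately show "\<exists>W. openin (zar V) W \<and> x \<in> W \<and> regular_on W (restrict (pairing L V l a) W)"
    using x i by auto
qed (simp add: pairing_def)

text \<open>The charts cover \<open>X\<close>, so the index picked by \<open>pairing\<close> belongs
  to a chart that really contains the point. Elsewhere the operations of \<open>line_sheaf\<close>
  return \<open>undefined\<close>.\<close>

lemma LEAST_chart: "x \<in> X \<Longrightarrow> x \<in> U (LEAST i. x \<in> U i)"
proof -
  assume "x \<in> X"
  then obtain i where "x \<in> U i"
    using lb by (auto simp: L line_bundle_def)
  then show ?thesis by (rule LeastI)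
qed

lemma pairing_add:
  assumes V: "openin (zar X) V"
  shows "pairing L V l (a \<oplus>\<^bsub>sec (line_sheaf L) V\<^esub> b) = pairing L V l a \<oplus>\<^bsub>reg V\<^esub> pairing L V l b"
proof (rule ext)
  fix x
  have "x \<in> U (LEAST i. x \<in> U i)" if "x \<in> V"
    using LEAST_chart that openin_zar_subset[OF V] by blast
  then show "pairing L V l (a \<oplus>\<^bsub>sec (line_sheaf L) V\<^esub> b) x = (pairing L V l a \<oplus>\<^bsub>reg V\<^esub> pairing L V l b) x"
    by (simp add: pairing_def L line_sheaf_ops Let_def distrib_left)
qed

lemma pairing_smult:
  assumes V: "openin (zar X) V"
  shows "pairing L V l (f \<odot>\<^bsub>sec (line_sheaf L) V\<^esub> a) = f \<otimes>\<^bsub>reg V\<^esub> pairing L V l a"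
proof (rule ext)
  fix x
  have "x \<in> U (LEAST i. x \<in> U i)" if "x \<in> V"
    using LEAST_chart that openin_zar_subset[OF V] by blast
  then show "pairing L V l (f \<odot>\<^bsub>sec (line_sheaf L) V\<^esub> a) x = (f \<otimes>\<^bsub>reg V\<^esub> pairing L V l a) x"
    by (simp add: pairing_def L line_sheaf_ops Let_def)
qed

lemma pairing_res:
  assumes V: "openin (zar X) V" and W: "W \<subseteq> V"
  shows "pairing L W (res (line_sheaf (dual_bundle L)) V W l) (res (line_sheaf L) V W a) =
    restrict (pairing L V l a) W"
proof (rule ext)
  fix x
  have "x \<in> U (LEAST i. x \<in> U i)" if "x \<in> V"
    using LEAST_chart that openin_zar_subset[OF V] by blast
  then show "pairing L W (res (line_sheaf (dual_bundle L)) V W l) (res (line_sheaf L) V W a) x =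
      restrict (pairing L V l a) W x"
    using W by (auto simp: pairing_def L line_sheaf_ops dual_bundle_def Let_def)
qed

end

section \<open>The skyscraper sheaf\<close>

lemma skyscraper_simps:
  "carrier (sec (skyscraper x) U) = (if x \<in> U then UNIV else {0})"
  "c \<oplus>\<^bsub>sec (skyscraper x) U\<^esub> d = c + d" "\<zero>\<^bsub>sec (skyscraper x) U\<^esub> = 0"
  "f \<odot>\<^bsub>sec (skyscraper x) U\<^esub> c = (if x \<in> U then f x * c else 0)"
  "res (skyscraper x) U V c = (if x \<in> V then c else 0)"
  by (simp_all add: skyscraper_def)

lemma skyscraper_module_presheaf: "module_presheaf X (skyscraper x)"
  unfolding module_presheaf_def
proof (intro conjI allI impI ballI, goal_cases)
  case (1 U)
  show ?case
  proof (intro moduleI cring_reg openin_zar_points[OF 1] abelian_groupI)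
    fix c assume "c \<in> carrier (sec (skyscraper x) U)"
    then show "\<exists>d\<in>carrier (sec (skyscraper x) U). d \<oplus>\<^bsub>sec (skyscraper x) U\<^esub> c = \<zero>\<^bsub>sec (skyscraper x) U\<^esub>"
      by (intro bexI[of _ "- c"]) (simp_all add: skyscraper_simps split: if_splits)
  qed (simp_all add: skyscraper_simps distrib_left distrib_right split: if_splits)
qed (auto simp: skyscraper_simps split: if_splits)

section \<open>Tensor products of presheaves\<close>

lemma module_presheaf_module:
  "module_presheaf X F \<Longrightarrow> openin (zar X) U \<Longrightarrow> Module.module (reg U) (sec F U)"
  by (simp add: module_presheaf_def)

lemma module_presheaf_res_hom:
  "module_presheaf X F \<Longrightarrow> openin (zar X) U \<Longrightarrow> openin (zar X) V \<Longrightarrow> V \<subseteq> U \<Longrightarrow>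
    res F U V \<in> hom (add_monoid (sec F U)) (add_monoid (sec F V))"
  by (simp add: module_presheaf_def hom_def)

lemma module_presheaf_res_closed:
  "module_presheaf X F \<Longrightarrow> openin (zar X) U \<Longrightarrow> openin (zar X) V \<Longrightarrow> V \<subseteq> U \<Longrightarrow>
    s \<in> carrier (sec F U) \<Longrightarrow> res F U V s \<in> carrier (sec F V)"
  using hom_in_carrier[OF module_presheaf_res_hom, of X F U V s] by simp

lemma module_presheaf_res_smult:
  "module_presheaf X F \<Longrightarrow> openin (zar X) U \<Longrightarrow> openin (zar X) V \<Longrightarrow> V \<subseteq> U \<Longrightarrow>
    regular_on U f \<Longrightarrow> s \<in> carrier (sec F U) \<Longrightarrow>
    res F U V (f \<odot>\<^bsub>sec F U\<^esub> s) = restrict f V \<odot>\<^bsub>sec F V\<^esub> res F U V s"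
  by (simp add: module_presheaf_def)

lemma module_presheaf_res_trans:
  "module_presheaf X F \<Longrightarrow> openin (zar X) U \<Longrightarrow> openin (zar X) V \<Longrightarrow> openin (zar X) W \<Longrightarrow>
    W \<subseteq> V \<Longrightarrow> V \<subseteq> U \<Longrightarrow> s \<in> carrier (sec F U) \<Longrightarrow> res F V W (res F U V s) = res F U W s"
  unfolding module_presheaf_def by simp

lemma tensor_presheaf_sec: "sec (tensor_presheaf F G) U = tensor_module (reg U) (sec F U) (sec G U)"
  and tensor_presheaf_res: "res (tensor_presheaf F G) U V =
    tensor_map (reg V) (sec F V) (sec G V) (res F U V) (res G U V)"
  by (simp_all add: tensor_presheaf_def)

abbreviation tensor_sum ::
    "'a presheaf \<Rightarrow> 'b presheaf \<Rightarrow> pt set \<Rightarrow> nat \<Rightarrow> (nat \<Rightarrow> 'a) \<Rightarrow> (nat \<Rightarrow> 'b) \<Rightarrow> (('a \<times> 'b) \<Rightarrow>\<^sub>0 int) set" where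
  "tensor_sum F G W n m a \<equiv> \<Oplus>\<^bsub>sec (tensor_presheaf F G) W\<^esub>k\<in>{..<n}.
     pure_tensor (reg W) (sec F W) (sec G W) (m k) (a k)"

text \<open>A section belongs to its own germ, hence to the other one, and membership there means
  agreement on a smaller neighbourhood.\<close>

lemma germ_eqD:
  assumes "germ X P x U s = germ X P x V t"
    and "openin (zar X) V" "x \<in> V" "t \<in> carrier (sec P V)"
  obtains W where "openin (zar X) W" "x \<in> W" "W \<subseteq> U" "W \<subseteq> V" "res P U W s = res P V W t"
proof -
  have "(V, t) \<in> germ X P x V t"
    unfolding germ_def using assms(2-4) by blast
  then have "(V, t) \<in> germ X P x U s"
    using assms(1) by simp
  then show thesis
    unfolding germ_def using that by blast
qed

locale presheaf_pair =
  fixes X :: "pt set" and F :: "'a presheaf" and G :: "'b presheaf"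
  assumes F: "module_presheaf X F" and G: "module_presheaf X G"
begin

abbreviation T where "T \<equiv> tensor_presheaf F G"

lemma two_modules: "openin (zar X) U \<Longrightarrow> two_modules (reg U) (sec F U) (sec G U)"
  using module_presheaf_module[OF F] module_presheaf_module[OF G] by (simp add: two_modules_def)

lemma res_tensor_hom:
  assumes "openin (zar X) U" "openin (zar X) V" "V \<subseteq> U"
  shows "tensor_hom (reg U) (sec F U) (sec G U) (reg V) (sec F V) (sec G V)
    (\<lambda>f. restrict f V) (res F U V) (res G U V)"
  using assms two_modules module_presheaf_res_hom[OF F assms] module_presheaf_res_hom[OF G assms]
    module_presheaf_res_smult[OF F assms] module_presheaf_res_smult[OF G assms]
  by (simp add: tensor_hom_def tensor_hom_axioms_def regular_on_restrict)

lemma res_tensor_sum: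
  assumes "openin (zar X) U" "openin (zar X) V" "V \<subseteq> U"
    and "\<And>k. k < n \<Longrightarrow> m k \<in> carrier (sec F U)" "\<And>k. k < n \<Longrightarrow> a k \<in> carrier (sec G U)"
  shows "res T U V (tensor_sum F G U n m a) = tensor_sum F G V n (\<lambda>k. res F U V (m k)) (\<lambda>k. res G U V (a k))"
  using tensor_hom.tensor_map_sum[OF res_tensor_hom[OF assms(1-3)] assms(4,5)]
  by (simp add: tensor_presheaf_sec tensor_presheaf_res)

lemma tensor_sum_closed:
  assumes "openin (zar X) U" "\<And>k. k < n \<Longrightarrow> m k \<in> carrier (sec F U)" "\<And>k. k < n \<Longrightarrow> a k \<in> carrier (sec G U)"
  shows "tensor_sum F G U n m a \<in> carrier (sec T U)"
  using two_modules.tensor_sum_closed[OF two_modules[OF assms(1)] assms(2,3)] by (simp add: tensor_presheaf_sec)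

lemma obtain_tensor_sum:
  assumes "openin (zar X) U" "t \<in> carrier (sec T U)"
  obtains n m a where "\<forall>k<n. m k \<in> carrier (sec F U) \<and> a k \<in> carrier (sec G U)"
    "t = tensor_sum F G U n m a"
proof -
  have "t \<in> carrier (tensor_module (reg U) (sec F U) (sec G U))"
    using assms(2) by (simp add: tensor_presheaf_sec)
  from two_modules.tensor_eq_finsum_pure[OF two_modules[OF assms(1)] this] show thesis
  proof cases
    case (1 n m a)
    then show thesis
      using that[of n m a] by (simp add: tensor_presheaf_sec)
  qed
qed

lemma tensor_res_closed:
  assumes "openin (zar X) U" "openin (zar X) V" "V \<subseteq> U" "t \<in> carrier (sec T U)"
  shows "res T U V t \<in> carrier (sec T V)"
  using assms(4) hom_in_carrier[OF tensor_hom.tensor_map_hom[OF res_tensor_hom[OF assms(1-3)]], of t]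
  by (simp add: tensor_presheaf_sec tensor_presheaf_res)

lemma tensor_sum_cong:
  assumes "openin (zar X) U"
    and "\<And>k. k < n \<Longrightarrow> m k = m' k" "\<And>k. k < n \<Longrightarrow> a k = a' k"
    and "\<And>k. k < n \<Longrightarrow> m' k \<in> carrier (sec F U)" "\<And>k. k < n \<Longrightarrow> a' k \<in> carrier (sec G U)"
  shows "tensor_sum F G U n m a = tensor_sum F G U n m' a'"
proof -
  interpret M: two_modules "reg U" "sec F U" "sec G U"
    by (rule two_modules[OF assms(1)])
  interpret T: abelian_group "tensor_module (reg U) (sec F U) (sec G U)"
    by (rule M.abelian_group_tensor_module)
  show ?thesis
    unfolding tensor_presheaf_sec
    using assms by (intro T.finsum_cong') (simp_all add: M.pure_tensor_closed)
qed

text \<open>Restriction acts on a sum of pure tensors factor by factor, so functoriality is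
  inherited from \<open>F\<close> and \<open>G\<close>.\<close>

lemma tensor_res_trans:
  assumes U: "openin (zar X) U" and V: "openin (zar X) V" and W: "openin (zar X) W"
    and sub: "W \<subseteq> V" "V \<subseteq> U" and t: "t \<in> carrier (sec T U)"
  shows "res T V W (res T U V t) = res T U W t"
proof -
  obtain n m a where "\<forall>k<n. m k \<in> carrier (sec F U) \<and> a k \<in> carrier (sec G U)"
    and t_eq: "t = tensor_sum F G U n m a"
    using obtain_tensor_sum[OF U t] by blast
  then have ma: "\<And>k. k < n \<Longrightarrow> m k \<in> carrier (sec F U)" "\<And>k. k < n \<Longrightarrow> a k \<in> carrier (sec G U)"
    by blast+
  have WU: "W \<subseteq> U" using sub by simp
  have "res T V W (res T U V t) = tensor_sum F G W n (\<lambda>k. res F V W (res F U V (m k))) (\<lambda>k. res G V W (res G U V (a k)))"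
    unfolding t_eq using ma(1,2) module_presheaf_res_closed[OF F U V sub(2)] module_presheaf_res_closed[OF G U V sub(2)]
    by (simp add: res_tensor_sum[OF U V sub(2)] res_tensor_sum[OF V W sub(1)])
  also have "\<dots> = tensor_sum F G W n (\<lambda>k. res F U W (m k)) (\<lambda>k. res G U W (a k))"
    by (rule tensor_sum_cong[OF W])
       (simp_all add: ma(1,2) module_presheaf_res_trans[OF F U V W sub] module_presheaf_res_trans[OF G U V W sub]
         module_presheaf_res_closed[OF F U W WU] module_presheaf_res_closed[OF G U W WU])
  also have "\<dots> = res T U W t"
    unfolding t_eq using ma(1,2) by (simp add: res_tensor_sum[OF U W WU])
  finally show ?thesis .
qed

text \<open>A neighbourhood on which two sections agree may be shrunk into \<open>W\<close>, since
  restriction in the tensor presheaf is functorial.\<close>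

lemma germ_res:
  assumes V: "openin (zar X) V" and W: "openin (zar X) W" and sub: "W \<subseteq> V"
    and x: "x \<in> W" and t: "t \<in> carrier (sec T V)"
  shows "germ X T x W (res T V W t) = germ X T x V t"
proof (intro equalityI subsetI; clarify)
  fix U u assume "(U, u) \<in> germ X T x W (res T V W t)"
  then obtain W' where "openin (zar X) U" "x \<in> U" "u \<in> carrier (sec T U)"
    "openin (zar X) W'" "x \<in> W'" "W' \<subseteq> W \<inter> U" "res T W W' (res T V W t) = res T U W' u"
    unfolding germ_def by blast
  moreover from this have "res T W W' (res T V W t) = res T V W' t"
    using tensor_res_trans[OF V W _ _ sub t] by simp
  ultimately show "(U, u) \<in> germ X T x V t"
    unfolding germ_def using sub by (auto intro!: exI[of _ W'])
next
  fix U u assume "(U, u) \<in> germ X T x V t"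
  then obtain W' where U: "openin (zar X) U" "x \<in> U" "u \<in> carrier (sec T U)"
    and W': "openin (zar X) W'" "x \<in> W'" "W' \<subseteq> V" "W' \<subseteq> U" "res T V W' t = res T U W' u"
    unfolding germ_def by blast
  have o: "openin (zar X) (W' \<inter> W)"
    using W'(1) W by (rule openin_Int)
  have "res T W (W' \<inter> W) (res T V W t) = res T V (W' \<inter> W) t"
    by (rule tensor_res_trans[OF V W o _ sub t]) simp
  also have "\<dots> = res T W' (W' \<inter> W) (res T V W' t)"
    by (rule tensor_res_trans[OF V W'(1) o _ W'(3) t, symmetric]) simp
  also have "\<dots> = res T U (W' \<inter> W) u"
    unfolding W'(5) by (rule tensor_res_trans[OF U(1) W'(1) o _ W'(4) U(3)]) simp
  finally show "(U, u) \<in> germ X T x W (res T V W t)"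
    unfolding germ_def using U o W' x by (auto intro!: exI[of _ "W' \<inter> W"])
qed

lemma germ_eqI:
  assumes "openin (zar X) U" "openin (zar X) V" "openin (zar X) W" "x \<in> W" "W \<subseteq> U" "W \<subseteq> V"
    and "s \<in> carrier (sec T U)" "t \<in> carrier (sec T V)" "res T U W s = res T V W t"
  shows "germ X T x U s = germ X T x V t"
  using germ_res[OF assms(1,3,5,4,7)] germ_res[OF assms(2,3,6,4,8)] assms(9) by simp

end

section \<open>The evaluation map\<close>

text \<open>The contraction with \<open>l\<close> of the tensor \<Sum> m k \<otimes> a k, which is
  the local formula for the evaluation map.\<close>

abbreviation pairing_sum ::
    "'a presheaf \<Rightarrow> line_bundle_data \<Rightarrow> pt set \<Rightarrow> (nat \<Rightarrow> pt \<Rightarrow> complex) \<Rightarrow> nat \<Rightarrow> (nat \<Rightarrow> 'a) \<Rightarrow>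
      (nat \<Rightarrow> nat \<Rightarrow> pt \<Rightarrow> complex) \<Rightarrow> 'a" where
  "pairing_sum F L W l n m a \<equiv> \<Oplus>\<^bsub>sec F W\<^esub>k\<in>{..<n}. pairing L W l (a k) \<odot>\<^bsub>sec F W\<^esub> m k"

text \<open>Kept at the level of presheaves so that it serves both \<open>F\<close> and the
  skyscraper sheaf; gluing enters in \<open>line_bundle_sheaf_twist\<close>.\<close>

locale line_bundle_twist =
  fixes X :: "pt set" and F :: "'a presheaf" and L :: line_bundle_data
  assumes F: "module_presheaf X F" and L: "line_bundle X L"
begin

sublocale presheaf_pair X F "line_sheaf L"
  by unfold_locales (fact F, rule line_sheaf_module_presheaf)

abbreviation dual where "dual \<equiv> line_sheaf (dual_bundle L)"

lemma pairing_closed: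
  assumes "openin (zar X) V" "l \<in> carrier (sec dual V)" "a \<in> carrier (sec (line_sheaf L) V)"
  shows "regular_on V (pairing L V l a)"
  using pairing_regular[OF L prod.collapse[symmetric] assms] .

lemma pairing_sum_closed:
  assumes "openin (zar X) W" "l \<in> carrier (sec dual W)"
    and "\<And>k. k < n \<Longrightarrow> m k \<in> carrier (sec F W)" "\<And>k. k < n \<Longrightarrow> a k \<in> carrier (sec (line_sheaf L) W)"
  shows "pairing_sum F L W l n m a \<in> carrier (sec F W)"
proof -
  interpret M: module "reg W" "sec F W"
    by (rule module_presheaf_module[OF F assms(1)])
  show ?thesis
    using assms by (intro M.finsum_closed) (auto intro!: M.smult_closed simp: pairing_closed)
qed

text \<open>The contraction depends on the tensor alone. Equal sums need not match term by term, but
  (m, a) \<mapsto> \<langle>l, a\<rangle> m is biadditive and balanced, and its lift sends the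
  common tensor to both sides.\<close>

lemma pairing_sum_cong:
  assumes W: "openin (zar X) W" and l: "l \<in> carrier (sec dual W)"
    and "\<And>k. k < n \<Longrightarrow> m k \<in> carrier (sec F W)" "\<And>k. k < n \<Longrightarrow> a k \<in> carrier (sec (line_sheaf L) W)"
    and "\<And>k. k < p \<Longrightarrow> m' k \<in> carrier (sec F W)" "\<And>k. k < p \<Longrightarrow> a' k \<in> carrier (sec (line_sheaf L) W)"
    and eq: "tensor_sum F (line_sheaf L) W n m a = tensor_sum F (line_sheaf L) W p m' a'"
  shows "pairing_sum F L W l n m a = pairing_sum F L W l p m' a'"
proof -
  interpret M: module "reg W" "sec F W"
    by (rule module_presheaf_module[OF F W])
  interpret N: two_modules "reg W" "sec F W" "sec (line_sheaf L) W"
    by (rule two_modules[OF W])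
  note closed = pairing_closed[OF W l]
  obtain g where g: "g \<in> hom (add_monoid (tensor_module (reg W) (sec F W) (sec (line_sheaf L) W))) (add_monoid (sec F W))"
    and g_pure: "\<And>m a. m \<in> carrier (sec F W) \<Longrightarrow> a \<in> carrier (sec (line_sheaf L) W) \<Longrightarrow>
      g (pure_tensor (reg W) (sec F W) (sec (line_sheaf L) W) m a) = pairing L W l a \<odot>\<^bsub>sec F W\<^esub> m"
  proof (rule N.tensor_lift[of "sec F W" "\<lambda>m a. pairing L W l a \<odot>\<^bsub>sec F W\<^esub> m"])
    show "abelian_group (sec F W)" ..
  next
    fix m a b assume "m \<in> carrier (sec F W)" "a \<in> carrier (sec (line_sheaf L) W)" "b \<in> carrier (sec (line_sheaf L) W)"
    then show "pairing L W l (a \<oplus>\<^bsub>sec (line_sheaf L) W\<^esub> b) \<odot>\<^bsub>sec F W\<^esub> m =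
        pairing L W l a \<odot>\<^bsub>sec F W\<^esub> m \<oplus>\<^bsub>sec F W\<^esub> pairing L W l b \<odot>\<^bsub>sec F W\<^esub> m"
      unfolding pairing_add[OF L prod.collapse[symmetric] W] using closed
      by (intro M.smult_l_distr) simp_all
  next
    fix f m a assume A: "f \<in> carrier (reg W)" "m \<in> carrier (sec F W)" "a \<in> carrier (sec (line_sheaf L) W)"
    have p: "pairing L W l a \<in> carrier (reg W)"
      using closed A by simp
    \<comment> \<open>Balancing: the pairing takes \<open>f\<close> out of its second argument, and
      commutativity of \<open>reg W\<close> moves it next to \<open>m\<close>.\<close>
    show "pairing L W l a \<odot>\<^bsub>sec F W\<^esub> (f \<odot>\<^bsub>sec F W\<^esub> m) = pairing L W l (f \<odot>\<^bsub>sec (line_sheaf L) W\<^esub> a) \<odot>\<^bsub>sec F W\<^esub> m"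
      unfolding pairing_smult[OF L prod.collapse[symmetric] W]
      using M.smult_assoc1[OF p A(1,2)] M.m_comm[OF p A(1)] by simp
  qed (use closed in \<open>auto intro!: M.smult_closed M.smult_r_distr\<close>)
  have sum: "g (tensor_sum F (line_sheaf L) W q u b) = pairing_sum F L W l q u b"
    if "\<And>k. k < q \<Longrightarrow> u k \<in> carrier (sec F W)" "\<And>k. k < q \<Longrightarrow> b k \<in> carrier (sec (line_sheaf L) W)" for q u b
  proof -
    have "g (tensor_sum F (line_sheaf L) W q u b) =
        (\<Oplus>\<^bsub>sec F W\<^esub>k\<in>{..<q}. g (pure_tensor (reg W) (sec F W) (sec (line_sheaf L) W) (u k) (b k)))"
      unfolding tensor_presheaf_sec
      using that by (intro hom_finsum[OF N.abelian_group_tensor_module M.abelian_group_axioms g] N.pure_tensor_closed)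
    also have "\<dots> = pairing_sum F L W l q u b"
      using that closed by (intro M.finsum_cong') (auto simp: g_pure)
    finally show ?thesis .
  qed
  show ?thesis
    using sum[of n m a] sum[of p m' a'] assms by simp
qed

lemma pairing_sum_res:
  assumes V: "openin (zar X) V" and W: "openin (zar X) W" and sub: "W \<subseteq> V" and l: "l \<in> carrier (sec dual V)"
    and m: "\<And>k. k < n \<Longrightarrow> m k \<in> carrier (sec F V)" and a: "\<And>k. k < n \<Longrightarrow> a k \<in> carrier (sec (line_sheaf L) V)"
  shows "res F V W (pairing_sum F L V l n m a) =
    pairing_sum F L W (res dual V W l) n (\<lambda>k. res F V W (m k)) (\<lambda>k. res (line_sheaf L) V W (a k))"
proof -
  interpret M: module "reg V" "sec F V"
    by (rule module_presheaf_module[OF F V])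
  interpret M': module "reg W" "sec F W"
    by (rule module_presheaf_module[OF F W])
  have "res F V W (pairing_sum F L V l n m a) =
      (\<Oplus>\<^bsub>sec F W\<^esub>k\<in>{..<n}. res F V W (pairing L V l (a k) \<odot>\<^bsub>sec F V\<^esub> m k))"
    using m a pairing_closed[OF V l]
    by (intro hom_finsum[OF M.abelian_group_axioms M'.abelian_group_axioms module_presheaf_res_hom[OF F V W sub]]
        M.smult_closed) auto
  also have "\<dots> = pairing_sum F L W (res dual V W l) n (\<lambda>k. res F V W (m k)) (\<lambda>k. res (line_sheaf L) V W (a k))"
    unfolding pairing_res[OF L prod.collapse[symmetric] V sub]
    using m a pairing_closed[OF V l] sub
    by (intro M'.finsum_cong')
       (auto simp: module_presheaf_res_smult[OF F V W sub] regular_on_restrict[OF _ sub] module_presheaf_res_closed[OF F V W sub]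
         intro!: M'.smult_closed)
  finally show ?thesis .
qed

text \<open>Equal germs become equal tensors on some \<open>W''\<close>, where
  \<open>pairing_sum_cong\<close> applies. With \<open>F\<close> this makes evaluation well defined;
  with the skyscraper sheaf it turns a vanishing germ into a vanishing contraction.\<close>

lemma pairing_sum_local:
  assumes V: "openin (zar X) V" and l: "l \<in> carrier (sec dual V)"
    and W: "openin (zar X) W" "W \<subseteq> V" and W': "openin (zar X) W'" "W' \<subseteq> V"
    and ma: "\<forall>k<n. m k \<in> carrier (sec F W) \<and> a k \<in> carrier (sec (line_sheaf L) W)"
    and ma': "\<forall>k<p. m' k \<in> carrier (sec F W') \<and> a' k \<in> carrier (sec (line_sheaf L) W')"
    and x: "x \<in> W'"
    and eq: "germ X T x W (tensor_sum F (line_sheaf L) W n m a) =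
      germ X T x W' (tensor_sum F (line_sheaf L) W' p m' a')"
  obtains W'' where "openin (zar X) W''" "x \<in> W''" "W'' \<subseteq> W" "W'' \<subseteq> W'"
    "res F W W'' (pairing_sum F L W (res dual V W l) n m a) =
     res F W' W'' (pairing_sum F L W' (res dual V W' l) p m' a')"
proof -
  note dual = line_sheaf_module_presheaf[of X "dual_bundle L"]
  note line = line_sheaf_module_presheaf[of X L]
  obtain W'' where o: "openin (zar X) W''" and x'': "x \<in> W''" and sub: "W'' \<subseteq> W" "W'' \<subseteq> W'"
    and "res T W W'' (tensor_sum F (line_sheaf L) W n m a) =
      res T W' W'' (tensor_sum F (line_sheaf L) W' p m' a')"
    by (rule germ_eqD[OF eq W'(1) x]) (use ma' in \<open>auto intro!: tensor_sum_closed W'\<close>)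
  then have eq'': "tensor_sum F (line_sheaf L) W'' n (\<lambda>k. res F W W'' (m k)) (\<lambda>k. res (line_sheaf L) W W'' (a k)) =
      tensor_sum F (line_sheaf L) W'' p (\<lambda>k. res F W' W'' (m' k)) (\<lambda>k. res (line_sheaf L) W' W'' (a' k))"
    using ma ma' by (simp add: res_tensor_sum W(1) W'(1))
  \<comment> \<open>Both routes from \<open>V\<close> to \<open>W''\<close> restrict
    \<open>l\<close> to the same section, so the two contractions are taken against one
    element.\<close>
  have l_res: "res dual W W'' (res dual V W l) = res dual V W'' l"
    "res dual W' W'' (res dual V W' l) = res dual V W'' l"
    using module_presheaf_res_trans[OF dual V] W W' o sub l by blast+
  have l_closed: "res dual V W l \<in> carrier (sec dual W)" "res dual V W' l \<in> carrier (sec dual W')"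
    "res dual V W'' l \<in> carrier (sec dual W'')"
    using module_presheaf_res_closed[OF dual V] W W' o sub l by blast+
  have "res F W W'' (pairing_sum F L W (res dual V W l) n m a) =
      pairing_sum F L W'' (res dual V W'' l) n (\<lambda>k. res F W W'' (m k)) (\<lambda>k. res (line_sheaf L) W W'' (a k))"
    using pairing_sum_res[OF W(1) o sub(1) l_closed(1)] ma by (simp add: l_res)
  also have "\<dots> = pairing_sum F L W'' (res dual V W'' l) p (\<lambda>k. res F W' W'' (m' k)) (\<lambda>k. res (line_sheaf L) W' W'' (a' k))"
    using ma ma' module_presheaf_res_closed[OF F W(1) o sub(1)] module_presheaf_res_closed[OF line W(1) o sub(1)]
      module_presheaf_res_closed[OF F W'(1) o sub(2)] module_presheaf_res_closed[OF line W'(1) o sub(2)]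
    by (intro pairing_sum_cong[OF o l_closed(3) _ _ _ _ eq'']) auto
  also have "\<dots> = res F W' W'' (pairing_sum F L W' (res dual V W' l) p m' a')"
    using pairing_sum_res[OF W'(1) o sub(2) l_closed(2)] ma' by (simp add: l_res)
  finally show thesis
    using that o x'' sub by blast
qed

end

section \<open>Gluing local contractions\<close>

text \<open>Separatedness, extracted from unique gluing: on the cover by all open sets where
  \<open>s\<close> and \<open>t\<close> agree, both of them glue the restrictions of
  \<open>s\<close>.\<close>

lemma module_sheaf_eqI:
  assumes F: "module_sheaf X F" and U: "openin (zar X) U"
    and s: "s \<in> carrier (sec F U)" and t: "t \<in> carrier (sec F U)"
    and local: "\<And>x. x \<in> U \<Longrightarrow> \<exists>V. openin (zar X) V \<and> x \<in> V \<and> V \<subseteq> U \<and> res F U V s = res F U V t"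
  shows "s = t"
proof -
  define \<U> where "\<U> = {V. openin (zar X) V \<and> V \<subseteq> U \<and> res F U V s = res F U V t}"
  have pre: "module_presheaf X F"
    using F by (simp add: module_sheaf_def)
  have Un: "\<Union>\<U> = U"
    using local by (fastforce simp: \<U>_def)
  have "res F V (V \<inter> W) (res F U V s) = res F W (V \<inter> W) (res F U W s)" if "V \<in> \<U>" "W \<in> \<U>" for V W
  proof -
    have VW: "openin (zar X) V" "openin (zar X) W" "openin (zar X) (V \<inter> W)" "V \<subseteq> U" "W \<subseteq> U"
      using that openin_Int by (auto simp: \<U>_def)
    then show ?thesis
      using module_presheaf_res_trans[OF pre U VW(1,3) _ VW(4) s] module_presheaf_res_trans[OF pre U VW(2,3) _ VW(5) s]
      by simp
  qed
  moreover have "openin (zar X) V \<and> res F U V s \<in> carrier (sec F V)" if "V \<in> \<U>" for V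
    using that module_presheaf_res_closed[OF pre U _ _ s, of V] unfolding \<U>_def by blast
  ultimately have "\<exists>!u. u \<in> carrier (sec F U) \<and> (\<forall>V\<in>\<U>. res F U V u = res F U V s)"
    using conjunct2[OF F[unfolded module_sheaf_def], THEN spec, of \<U>, THEN spec, of "\<lambda>V. res F U V s"]
    unfolding Un by blast
  then show ?thesis
    using s t by (auto simp: \<U>_def)
qed

locale line_bundle_sheaf_twist =
  fixes X :: "pt set" and F :: "'a presheaf" and L :: line_bundle_data
  assumes F_sheaf: "module_sheaf X F" and L_bundle: "line_bundle X L"
begin

sublocale line_bundle_twist X F L
  using F_sheaf L_bundle by unfold_locales (auto simp: module_sheaf_def)

text \<open>The part of the description in \<open>evaluation\<close> that concerns \<open>s\<close>
  alone. Local expressions can then be compared before any \<open>l\<close> or any value is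
  fixed.\<close>

definition represents where
  "represents s W n m a \<longleftrightarrow> openin (zar X) W \<and>
     (\<forall>k<n. m k \<in> carrier (sec F W) \<and> a k \<in> carrier (sec (line_sheaf L) W)) \<and>
     (\<forall>y\<in>W. s y = germ X T y W (tensor_sum F (line_sheaf L) W n m a))"

lemma obtain_represents:
  assumes s: "s \<in> global_sections X (tensor_sheaf X F (line_sheaf L))"
    and V: "openin (zar X) V" and x: "x \<in> V"
  obtains W n m a where "represents s W n m a" "x \<in> W" "W \<subseteq> V"
proof -
  have "x \<in> X"
    using x openin_zar_subset[OF V] by blast
  then obtain V0 t where V0: "openin (zar X) V0" "x \<in> V0" and t: "t \<in> carrier (sec T V0)"
    and s_eq: "\<forall>y\<in>V0. s y = germ X T y V0 t"
    using s by (auto simp: global_sections_def tensor_sheaf_def sheafify_def)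
  \<comment> \<open>Sheafification supplies a neighbourhood inside \<open>X\<close>, not inside
    \<open>V\<close>, so it has to be cut down.\<close>
  have W: "openin (zar X) (V0 \<inter> V)"
    using V0(1) V by (rule openin_Int)
  have "res T V0 (V0 \<inter> V) t \<in> carrier (sec T (V0 \<inter> V))"
    by (rule tensor_res_closed[OF V0(1) W _ t]) simp
  from obtain_tensor_sum[OF W this] obtain n m a where
    ma: "\<forall>k<n. m k \<in> carrier (sec F (V0 \<inter> V)) \<and> a k \<in> carrier (sec (line_sheaf L) (V0 \<inter> V))"
    and eq: "res T V0 (V0 \<inter> V) t = tensor_sum F (line_sheaf L) (V0 \<inter> V) n m a"
    by blast
  have "s y = germ X T y (V0 \<inter> V) (tensor_sum F (line_sheaf L) (V0 \<inter> V) n m a)" if "y \<in> V0 \<inter> V" for y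
    using germ_res[OF V0(1) W _ that t] s_eq that eq by simp
  then have "represents s (V0 \<inter> V) n m a"
    unfolding represents_def using W ma by blast
  then show thesis
    using that x V0(2) by blast
qed

text \<open>Two expressions of \<open>s\<close> have equal germs at each point of the overlap. This
  gives equality of the contractions only on small neighbourhoods; separatedness of \<open>F\<close>
  extends it to all of \<open>W \<inter> W'\<close>.\<close>

lemma represents_compatible:
  assumes V: "openin (zar X) V" and l: "l \<in> carrier (sec dual V)"
    and r: "represents s W n m a" "W \<subseteq> V" and r': "represents s W' p m' a'" "W' \<subseteq> V"
  shows "res F W (W \<inter> W') (pairing_sum F L W (res dual V W l) n m a) =
    res F W' (W \<inter> W') (pairing_sum F L W' (res dual V W' l) p m' a')"
proof -
  note dual_presheaf = line_sheaf_module_presheaf[of X "dual_bundle L"]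
  have W: "openin (zar X) W" and W': "openin (zar X) W'"
    and ma: "\<forall>k<n. m k \<in> carrier (sec F W) \<and> a k \<in> carrier (sec (line_sheaf L) W)"
    and ma': "\<forall>k<p. m' k \<in> carrier (sec F W') \<and> a' k \<in> carrier (sec (line_sheaf L) W')"
    using r(1) r'(1) unfolding represents_def by auto
  have WW': "openin (zar X) (W \<inter> W')"
    using W W' by (rule openin_Int)
  have v: "pairing_sum F L W (res dual V W l) n m a \<in> carrier (sec F W)"
    using ma by (intro pairing_sum_closed W module_presheaf_res_closed[OF dual_presheaf V W r(2) l]) auto
  have v': "pairing_sum F L W' (res dual V W' l) p m' a' \<in> carrier (sec F W')"
    using ma' by (intro pairing_sum_closed W' module_presheaf_res_closed[OF dual_presheaf V W' r'(2) l]) auto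
  show ?thesis
  proof (rule module_sheaf_eqI[OF F_sheaf WW'])
    show "res F W (W \<inter> W') (pairing_sum F L W (res dual V W l) n m a) \<in> carrier (sec F (W \<inter> W'))"
      by (rule module_presheaf_res_closed[OF F W WW' _ v]) simp
    show "res F W' (W \<inter> W') (pairing_sum F L W' (res dual V W' l) p m' a') \<in> carrier (sec F (W \<inter> W'))"
      by (rule module_presheaf_res_closed[OF F W' WW' _ v']) simp
  next
    fix x assume x: "x \<in> W \<inter> W'"
    have s_x: "s x = germ X T x W (tensor_sum F (line_sheaf L) W n m a)"
      using r(1) IntD1[OF x] unfolding represents_def by blast
    have s_x': "s x = germ X T x W' (tensor_sum F (line_sheaf L) W' p m' a')"
      using r'(1) IntD2[OF x] unfolding represents_def by blast
    from pairing_sum_local[OF V l W r(2) W' r'(2) ma ma' IntD2[OF x] trans[OF s_x[symmetric] s_x']]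
    obtain W'' where W'': "openin (zar X) W''" "x \<in> W''" "W'' \<subseteq> W" "W'' \<subseteq> W'"
      "res F W W'' (pairing_sum F L W (res dual V W l) n m a) =
       res F W' W'' (pairing_sum F L W' (res dual V W' l) p m' a')"
      by blast
    moreover have "W'' \<subseteq> W \<inter> W'"
      using W''(3,4) by blast
    ultimately show "\<exists>U. openin (zar X) U \<and> x \<in> U \<and> U \<subseteq> W \<inter> W' \<and>
        res F (W \<inter> W') U (res F W (W \<inter> W') (pairing_sum F L W (res dual V W l) n m a)) =
        res F (W \<inter> W') U (res F W' (W \<inter> W') (pairing_sum F L W' (res dual V W' l) p m' a'))"
      using module_presheaf_res_trans[OF F W WW' W''(1) _ _ v] module_presheaf_res_trans[OF F W' WW' W''(1) _ _ v']
      by (intro exI[of _ W'']) simp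
  qed
qed

text \<open>The local values \<open>\<Sum> \<langle>l, a k\<rangle> m k\<close> agree on overlaps, and hence glue to the value of the
  evaluation map, so that the definite description in \<open>evaluation\<close> is proper.\<close>

lemma evaluation_represents:
  assumes s: "s \<in> global_sections X (tensor_sheaf X F (line_sheaf L))"
    and V: "openin (zar X) V" and l: "l \<in> carrier (sec dual V)"
  shows "evaluation X F L V s l \<in> carrier (sec F V)" (is ?closed)
    and "\<forall>x\<in>V. \<exists>W n m a. represents s W n m a \<and> x \<in> W \<and> W \<subseteq> V \<and>
      res F V W (evaluation X F L V s l) = pairing_sum F L W (res dual V W l) n m a" (is ?local)
proof -
  define val where "val W n m a = pairing_sum F L W (res dual V W l) n m a" for W n m a
  define ok where "ok v \<longleftrightarrow> v \<in> carrier (sec F V) \<and>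
    (\<forall>x\<in>V. \<exists>W n m a. represents s W n m a \<and> x \<in> W \<and> W \<subseteq> V \<and> res F V W v = val W n m a)" for v
  define \<U> where "\<U> = {W. W \<subseteq> V \<and> (\<exists>n m a. represents s W n m a)}"
  \<comment> \<open>Gluing takes one section for each open set, while several expressions of
    \<open>s\<close> may live on the same \<open>W\<close>. Any choice will do, since
    \<open>compatible\<close> relates arbitrary expressions.\<close>
  define c where "c W = (SOME v. \<exists>n m a. represents s W n m a \<and> v = val W n m a)" for W
  have c: "\<exists>n m a. represents s W n m a \<and> c W = val W n m a" if "W \<in> \<U>" for W
    unfolding c_def by (rule someI_ex) (use that in \<open>auto simp: \<U>_def\<close>)
  have val_closed: "val W n m a \<in> carrier (sec F W)" if "represents s W n m a" "W \<subseteq> V" for W n m a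
  proof -
    have W: "openin (zar X) W" and ma: "\<forall>k<n. m k \<in> carrier (sec F W) \<and> a k \<in> carrier (sec (line_sheaf L) W)"
      using that(1) unfolding represents_def by blast+
    have "res dual V W l \<in> carrier (sec dual W)"
      by (rule module_presheaf_res_closed[OF line_sheaf_module_presheaf V W that(2) l])
    then show ?thesis
      unfolding val_def by (rule pairing_sum_closed[OF W]) (use ma in auto)
  qed
  have compatible: "res F W (W \<inter> W') (val W n m a) = res F W' (W \<inter> W') (val W' p m' a')"
    if "represents s W n m a" "W \<subseteq> V" "represents s W' p m' a'" "W' \<subseteq> V" for W n m a W' p m' a'
    unfolding val_def by (rule represents_compatible[OF V l that])
  have open_U: "openin (zar X) W" if "W \<in> \<U>" for W
    using that by (auto simp: \<U>_def represents_def)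
  have Un: "\<Union>\<U> = V"
  proof
    show "V \<subseteq> \<Union>\<U>"
    proof
      fix x assume "x \<in> V"
      from obtain_represents[OF s V this] obtain W n m a where "represents s W n m a" "x \<in> W" "W \<subseteq> V" .
      then show "x \<in> \<Union>\<U>"
        unfolding \<U>_def by blast
    qed
  qed (auto simp: \<U>_def)
  have "\<exists>!v. v \<in> carrier (sec F (\<Union>\<U>)) \<and> (\<forall>W\<in>\<U>. res F (\<Union>\<U>) W v = c W)"
  proof -
    have "openin (zar X) W \<and> c W \<in> carrier (sec F W)" if W: "W \<in> \<U>" for W
    proof -
      obtain n m a where "represents s W n m a" "c W = val W n m a"
        using c[OF W] by blast
      then show ?thesis
        using val_closed[of W n m a] open_U[OF W] W by (simp add: \<U>_def)
    qed
    moreover have "res F W (W \<inter> W') (c W) = res F W' (W \<inter> W') (c W')" if "W \<in> \<U>" "W' \<in> \<U>" for W W'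
    proof -
      obtain n m a where "represents s W n m a" "c W = val W n m a"
        using c \<open>W \<in> \<U>\<close> by blast
      moreover obtain p m' a' where "represents s W' p m' a'" "c W' = val W' p m' a'"
        using c \<open>W' \<in> \<U>\<close> by blast
      ultimately show ?thesis
        using compatible[of W n m a W' p m' a'] that by (auto simp: \<U>_def)
    qed
    ultimately show ?thesis
      using conjunct2[OF F_sheaf[unfolded module_sheaf_def], THEN spec, of \<U>, THEN spec, of c] by blast
  qed
  then obtain v where v: "v \<in> carrier (sec F V)" "\<forall>W\<in>\<U>. res F V W v = c W"
    unfolding Un by blast
  have "ok v"
    unfolding ok_def
  proof (intro conjI ballI v(1))
    fix x assume "x \<in> V"
    then obtain W where W: "W \<in> \<U>" "x \<in> W"
      using Un by blast
    obtain n m a where "represents s W n m a" "c W = val W n m a"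
      using c[OF W(1)] by blast
    then show "\<exists>W n m a. represents s W n m a \<and> x \<in> W \<and> W \<subseteq> V \<and> res F V W v = val W n m a"
      using W v(2) unfolding \<U>_def
      by (intro exI[of _ W] exI[of _ n] exI[of _ m] exI[of _ a]) auto
  qed
  \<comment> \<open>Uniqueness: \<open>u\<close> and \<open>v\<close> may satisfy the description
    through unrelated expressions near \<open>x\<close>, so they are compared on the intersection of
    the two neighbourhoods.\<close>
  moreover have "u = v" if u: "ok u" for u
  proof (rule module_sheaf_eqI[OF F_sheaf V _ v(1)])
    show u_closed: "u \<in> carrier (sec F V)"
      using u by (simp add: ok_def)
    fix x assume x: "x \<in> V"
    obtain W n m a where W: "represents s W n m a" "x \<in> W" "W \<subseteq> V" "res F V W u = val W n m a"
      using u x unfolding ok_def by blast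
    obtain W' p m' a' where W': "represents s W' p m' a'" "x \<in> W'" "W' \<subseteq> V" "res F V W' v = val W' p m' a'"
      using \<open>ok v\<close> x unfolding ok_def by blast
    have o: "openin (zar X) W" "openin (zar X) W'"
      using W(1) W'(1) by (simp_all add: represents_def)
    then have o': "openin (zar X) (W \<inter> W')"
      by (rule openin_Int)
    have "res F V (W \<inter> W') u = res F W (W \<inter> W') (val W n m a)"
      using module_presheaf_res_trans[OF F V o(1) o' _ W(3) u_closed] W(4) by simp
    also have "\<dots> = res F W' (W \<inter> W') (val W' p m' a')"
      by (rule compatible[OF W(1,3) W'(1,3)])
    also have "\<dots> = res F V (W \<inter> W') v"
      using module_presheaf_res_trans[OF F V o(2) o' _ W'(3) v(1)] W'(4) by simp
    finally show "\<exists>U. openin (zar X) U \<and> x \<in> U \<and> U \<subseteq> V \<and> res F V U u = res F V U v"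
      using o' W(2,3) W'(2) by (intro exI[of _ "W \<inter> W'"]) auto
  qed
  ultimately have "ok (THE v. ok v)"
    by (rule theI)
  \<comment> \<open>Up to the order of the conjuncts, \<open>ok\<close> is the predicate described
    in \<open>evaluation\<close>.\<close>
  moreover have "ok = (\<lambda>v. v \<in> carrier (sec F V) \<and>
     (\<forall>x\<in>V. \<exists>W (n::nat) m a. openin (zar X) W \<and> x \<in> W \<and> W \<subseteq> V \<and>
        (\<forall>k<n. m k \<in> carrier (sec F W) \<and> a k \<in> carrier (sec (line_sheaf L) W)) \<and>
        (\<forall>y\<in>W. s y = germ X T y W (tensor_sum F (line_sheaf L) W n m a)) \<and>
        res F V W v = pairing_sum F L W (res dual V W l) n m a))"
    unfolding ok_def represents_def val_def by (intro ext) (simp add: conj_ac)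
  ultimately have "ok (evaluation X F L V s l)"
    unfolding evaluation_def by simp
  then show ?closed ?local
    unfolding ok_def val_def by blast+
qed

end

section \<open>Maps to skyscraper sheaves\<close>

lemma sheaf_hom_hom:
  "sheaf_hom X F G \<phi> \<Longrightarrow> openin (zar X) U \<Longrightarrow> \<phi> U \<in> hom (add_monoid (sec F U)) (add_monoid (sec G U))"
  by (simp add: sheaf_hom_def hom_def)

lemma sheaf_hom_closed:
  "sheaf_hom X F G \<phi> \<Longrightarrow> openin (zar X) U \<Longrightarrow> s \<in> carrier (sec F U) \<Longrightarrow> \<phi> U s \<in> carrier (sec G U)"
  using hom_in_carrier[OF sheaf_hom_hom, of X F G \<phi> U s] by simp

lemma sheaf_hom_smult:
  "sheaf_hom X F G \<phi> \<Longrightarrow> openin (zar X) U \<Longrightarrow> regular_on U f \<Longrightarrow> s \<in> carrier (sec F U) \<Longrightarrow>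
    \<phi> U (f \<odot>\<^bsub>sec F U\<^esub> s) = f \<odot>\<^bsub>sec G U\<^esub> \<phi> U s"
  by (simp add: sheaf_hom_def)

lemma sheaf_hom_res:
  "sheaf_hom X F G \<phi> \<Longrightarrow> openin (zar X) U \<Longrightarrow> openin (zar X) V \<Longrightarrow> V \<subseteq> U \<Longrightarrow> s \<in> carrier (sec F U) \<Longrightarrow>
    \<phi> V (res F U V s) = res G U V (\<phi> U s)"
  by (simp add: sheaf_hom_def)

locale sheaf_hom_tensor =
  source: presheaf_pair X F H + target: presheaf_pair X G H
  for X :: "pt set" and F :: "'a presheaf" and G :: "'b presheaf" and H :: "'c presheaf" +
  fixes \<phi> :: "pt set \<Rightarrow> 'a \<Rightarrow> 'b"
  assumes hom: "sheaf_hom X F G \<phi>"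
begin

text \<open>\<phi> \<otimes> id on the tensor presheaves, whose sheafification is
  \<open>tensor_sheaf_map\<close>.\<close>

definition \<psi> where "\<psi> U = tensor_map (reg U) (sec G U) (sec H U) (\<phi> U) (\<lambda>n. n)"

lemma tensor_hom: "openin (zar X) U \<Longrightarrow>
  tensor_hom (reg U) (sec F U) (sec H U) (reg U) (sec G U) (sec H U) (\<lambda>f. f) (\<phi> U) (\<lambda>n. n)"
  using source.two_modules target.two_modules sheaf_hom_hom[OF hom] sheaf_hom_smult[OF hom]
  by (simp add: tensor_hom_def tensor_hom_axioms_def) (simp add: hom_def)

lemma \<psi>_tensor_sum:
  assumes "openin (zar X) U" "\<And>k. k < n \<Longrightarrow> m k \<in> carrier (sec F U)" "\<And>k. k < n \<Longrightarrow> a k \<in> carrier (sec H U)"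
  shows "\<psi> U (tensor_sum F H U n m a) = tensor_sum G H U n (\<lambda>k. \<phi> U (m k)) a"
  unfolding \<psi>_def tensor_presheaf_sec using tensor_hom.tensor_map_sum[OF tensor_hom[OF assms(1)] assms(2,3)] .

lemma \<psi>_closed:
  assumes "openin (zar X) U" "t \<in> carrier (sec source.T U)"
  shows "\<psi> U t \<in> carrier (sec target.T U)"
  unfolding \<psi>_def
  using hom_in_carrier[OF tensor_hom.tensor_map_hom[OF tensor_hom[OF assms(1)]], of t] assms(2)
  by (simp add: tensor_presheaf_sec)

text \<open>On pure tensors both composites restrict the second factor, and on the first they agree
  by naturality of \<open>\<phi>\<close>.\<close>

lemma \<psi>_res:
  assumes U: "openin (zar X) U" and V: "openin (zar X) V" and sub: "V \<subseteq> U" and t: "t \<in> carrier (sec source.T U)"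
  shows "\<psi> V (res source.T U V t) = res target.T U V (\<psi> U t)"
proof -
  obtain n m a where "\<forall>k<n. m k \<in> carrier (sec F U) \<and> a k \<in> carrier (sec H U)"
    and t: "t = tensor_sum F H U n m a"
    using source.obtain_tensor_sum[OF U t] by blast
  then have m: "\<And>k. k < n \<Longrightarrow> m k \<in> carrier (sec F U)" and a: "\<And>k. k < n \<Longrightarrow> a k \<in> carrier (sec H U)"
    by blast+
  note closed = module_presheaf_res_closed[OF source.F U V sub] module_presheaf_res_closed[OF source.G U V sub]
    sheaf_hom_closed[OF hom]
  have "\<psi> V (res source.T U V t) = tensor_sum G H V n (\<lambda>k. \<phi> V (res F U V (m k))) (\<lambda>k. res H U V (a k))"
    unfolding t using m a closed by (simp add: source.res_tensor_sum[OF U V sub] \<psi>_tensor_sum[OF V])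
  also have "\<dots> = tensor_sum G H V n (\<lambda>k. res G U V (\<phi> U (m k))) (\<lambda>k. res H U V (a k))"
    by (rule target.tensor_sum_cong[OF V])
       (simp_all add: m a closed U sheaf_hom_res[OF hom U V sub] module_presheaf_res_closed[OF target.F U V sub])
  also have "\<dots> = res target.T U V (\<psi> U t)"
    unfolding t using m a closed by (simp add: target.res_tensor_sum[OF U V sub] \<psi>_tensor_sum[OF U] U)
  finally show ?thesis .
qed

text \<open>The definite description in \<open>sheafify_map\<close> is proper: two sections with the
  same germ agree near \<open>x\<close>, and as \<open>\<psi>\<close> commutes with restriction, so
  do their images. Any local expression of \<open>s\<close> may therefore be used to compute the
  map.\<close>

lemma tensor_sheaf_map_germ:
  assumes x: "x \<in> U" "x \<in> W" and W: "openin (zar X) W" and t: "t \<in> carrier (sec source.T W)"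
    and s: "s x = germ X source.T x W t"
  shows "tensor_sheaf_map X F G H \<phi> U s x = germ X target.T x W (\<psi> W t)"
proof -
  have "(THE g. \<exists>V u. openin (zar X) V \<and> x \<in> V \<and> u \<in> carrier (sec source.T V) \<and>
      s x = germ X source.T x V u \<and> g = germ X target.T x V (\<psi> V u)) = germ X target.T x W (\<psi> W t)"
  proof (rule the_equality)
    show "\<exists>V u. openin (zar X) V \<and> x \<in> V \<and> u \<in> carrier (sec source.T V) \<and>
      s x = germ X source.T x V u \<and> germ X target.T x W (\<psi> W t) = germ X target.T x V (\<psi> V u)"
      using assms by blast
  next
    fix g assume "\<exists>V u. openin (zar X) V \<and> x \<in> V \<and> u \<in> carrier (sec source.T V) \<and>
      s x = germ X source.T x V u \<and> g = germ X target.T x V (\<psi> V u)"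
    then obtain V u where V: "openin (zar X) V" "x \<in> V" and u: "u \<in> carrier (sec source.T V)"
      and eq: "germ X source.T x V u = germ X source.T x W t" and g: "g = germ X target.T x V (\<psi> V u)"
      using s by auto
    from germ_eqD[OF eq W x(2) t] obtain W' where W': "openin (zar X) W'" "x \<in> W'" "W' \<subseteq> V" "W' \<subseteq> W"
      "res source.T V W' u = res source.T W W' t"
      by blast
    show "g = germ X target.T x W (\<psi> W t)"
      unfolding g using \<psi>_res[OF V(1) W'(1,3) u] \<psi>_res[OF W W'(1,4) t] W'(5)
      by (intro target.germ_eqI[OF V(1) W W'(1-4)] \<psi>_closed V W u t) simp
  qed
  then show ?thesis
    using x(1) by (simp add: tensor_sheaf_map_def sheafify_map_def \<psi>_def)
qed

end

section \<open>Pic0 and the contradiction at a basepoint\<close>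

text \<open>Openness is tested on a Picard variety \<open>A\<close>. Its points parametrise elements
  of \<open>Pic0 X\<close>, so the set in question is all of \<open>A\<close>.\<close>

lemma Pic0_open_Pic0: "Pic0_open X (Pic0 X)"
  unfolding Pic0_open_def
proof (intro conjI allI impI)
  fix A P assume A: "picard_variety X A P"
  then have "{a \<in> A. bundle_class X (fibre_bundle X P a) \<in> Pic0 X} = A"
    by (auto simp: picard_variety_def dest: bij_betwE)
  moreover obtain N where "closedin (zar (proj N)) A"
    using A by (auto simp: picard_variety_def projective_variety_def)
  then have "A \<subseteq> points"
    using closedin_subset by (fastforce simp: zar_def topspace_zariski)
  ultimately show "openin (zar A) {a \<in> A. bundle_class X (fibre_bundle X P a) \<in> Pic0 X}"
    using openin_zar_self by simp
qed simp

lemma Pic0_nonempty: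
  assumes X: "X \<subseteq> points"
  shows "Pic0 X \<noteq> {}"
proof -
  \<comment> \<open>The trivial bundle, with \<open>X\<close> itself as the chart for every
    index.\<close>
  define L :: line_bundle_data where "L = (\<lambda>_. X, \<lambda>_ _. \<lambda>x\<in>X. 1)"
  have "line_bundle X L"
    using X by (simp add: L_def line_bundle_def openin_zar_self regular_on_const)
  moreover have "topologically_trivial L"
    unfolding topologically_trivial_def L_def prod.case
    by (rule exI[of _ "\<lambda>_ _. 1"]) simp
  ultimately show ?thesis
    unfolding Pic0_def by blast
qed

lemma Pic0_line_bundle: "p \<in> Pic0 X \<Longrightarrow> L \<in> p \<Longrightarrow> line_bundle X L"
  by (auto simp: Pic0_def bundle_class_def)

text \<open>Contraction commutes with \<open>\<phi>\<close>: by linearity, \<phi> (\<Sum>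
  \<langle>l, a k\<rangle> m k) = \<Sum> \<langle>l, a k\<rangle> \<phi> (m k). The right side is
  the contraction of a tensor whose germ at \<open>x\<close> is the value there of (\<phi> \<otimes>
  id) s, hence zero.\<close>

lemma evaluation_in_kernel:
  assumes F: "module_sheaf X F" and X: "X \<subseteq> points" and L: "line_bundle X L"
    and \<phi>: "sheaf_hom X F (skyscraper x) \<phi>"
    and s: "s \<in> global_sections X (tensor_sheaf X F (line_sheaf L))"
    and zero: "tensor_sheaf_map X F (skyscraper x) (line_sheaf L) \<phi> X s =
      \<zero>\<^bsub>sec (tensor_sheaf X (skyscraper x) (line_sheaf L)) X\<^esub>"
    and V: "openin (zar X) V" and x: "x \<in> V"
    and l: "l \<in> carrier (sec (line_sheaf (dual_bundle L)) V)"
  shows "\<phi> V (evaluation X F L V s l) = 0"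
proof -
  interpret F: line_bundle_sheaf_twist X F L
    by unfold_locales fact+
  interpret S: line_bundle_twist X "skyscraper x" L
    by unfold_locales (fact skyscraper_module_presheaf L)+
  interpret M: sheaf_hom_tensor X F "skyscraper x" "line_sheaf L" \<phi>
    by unfold_locales fact
  have x_X: "x \<in> X"
    using x openin_zar_subset[OF V] by blast
  have X_open: "openin (zar X) X"
    by (rule openin_zar_self[OF X])
  obtain W n m a where r: "F.represents s W n m a" and W: "x \<in> W" "W \<subseteq> V"
    and v: "res F V W (evaluation X F L V s l) = pairing_sum F L W (res F.dual V W l) n m a"
    using F.evaluation_represents(2)[OF s V l] x by blast
  have W_open: "openin (zar X) W"
    and m: "\<And>k. k < n \<Longrightarrow> m k \<in> carrier (sec F W)"
    and a: "\<And>k. k < n \<Longrightarrow> a k \<in> carrier (sec (line_sheaf L) W)"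
    and s_x: "s x = germ X F.T x W (tensor_sum F (line_sheaf L) W n m a)"
    using r W(1) by (auto simp: F.represents_def)
  define l' where "l' = res F.dual V W l"
  have l': "l' \<in> carrier (sec F.dual W)"
    unfolding l'_def by (rule module_presheaf_res_closed[OF line_sheaf_module_presheaf V W_open W(2) l])
  interpret FW: module "reg W" "sec F W"
    by (rule module_presheaf_module[OF F.F W_open])
  interpret SW: module "reg W" "sec (skyscraper x) W"
    by (rule module_presheaf_module[OF S.F W_open])
  have \<phi>m: "\<phi> W (m k) \<in> carrier (sec (skyscraper x) W)" if "k < n" for k
    using sheaf_hom_closed[OF \<phi> W_open m[OF that]] .
  have closed: "tensor_sum F (line_sheaf L) W n m a \<in> carrier (sec F.T W)"
    by (rule F.tensor_sum_closed[OF W_open m a])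
  have "germ X S.T x W (tensor_sum (skyscraper x) (line_sheaf L) W n (\<lambda>k. \<phi> W (m k)) a) =
      tensor_sheaf_map X F (skyscraper x) (line_sheaf L) \<phi> X s x"
    using M.tensor_sheaf_map_germ[of x X W _ s, OF x_X W(1) W_open closed s_x]
    by (simp add: M.\<psi>_tensor_sum[OF W_open m a])
  also have "\<dots> = germ X S.T x X \<zero>\<^bsub>sec S.T X\<^esub>"
    using x_X by (simp add: zero tensor_sheaf_def sheafify_def)
  \<comment> \<open>Zero is written as the empty tensor sum and then moved from \<open>X\<close> to
    \<open>W\<close>, so that \<open>pairing_sum_local\<close> can compare it with the other sum;
    the dummy terms \<open>0\<close> and \<open>undefined\<close> are never evaluated.\<close>
  also have "\<zero>\<^bsub>sec S.T X\<^esub> = tensor_sum (skyscraper x) (line_sheaf L) X 0 (\<lambda>_. 0) (\<lambda>_. undefined)"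
    using two_modules.abelian_group_tensor_module[OF S.two_modules[OF X_open]]
    by (simp add: tensor_presheaf_sec abelian_monoid.finsum_empty abelian_group.axioms(1))
  also have "germ X S.T x X \<dots> = germ X S.T x W (res S.T X W \<dots>)"
    by (rule S.germ_res[OF X_open W_open openin_zar_subset[OF W_open] W(1), symmetric])
       (rule S.tensor_sum_closed[OF X_open]; simp)
  also have "res S.T X W (tensor_sum (skyscraper x) (line_sheaf L) X 0 (\<lambda>_. 0) (\<lambda>_. undefined)) =
      tensor_sum (skyscraper x) (line_sheaf L) W 0 (\<lambda>_. 0) (\<lambda>_. undefined)"
    by (subst S.res_tensor_sum[OF X_open W_open openin_zar_subset[OF W_open]]) (simp_all only: not_less0 lessThan_0
        abelian_monoid.finsum_empty[OF abelian_group.axioms(1)[OF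
          two_modules.abelian_group_tensor_module[OF S.two_modules[OF W_open]]]] tensor_presheaf_sec)
  finally have eq: "germ X S.T x W (tensor_sum (skyscraper x) (line_sheaf L) W n (\<lambda>k. \<phi> W (m k)) a) =
      germ X S.T x W (tensor_sum (skyscraper x) (line_sheaf L) W 0 (\<lambda>_. 0) (\<lambda>_. undefined))" .
  have "pairing_sum (skyscraper x) L W l' n (\<lambda>k. \<phi> W (m k)) a = 0"
  proof -
    \<comment> \<open>Since \<open>x\<close> lies in \<open>W''\<close>, restriction to
      \<open>W''\<close> is the identity on these sections, and the contraction equals the empty
      sum.\<close>
    obtain W'' where "x \<in> W''" "res (skyscraper x) W W'' (pairing_sum (skyscraper x) L W l' n (\<lambda>k. \<phi> W (m k)) a) =
       res (skyscraper x) W W'' (pairing_sum (skyscraper x) L W l' 0 (\<lambda>_. 0) (\<lambda>_. undefined))"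
      by (rule S.pairing_sum_local[OF V l W_open W(2) W_open W(2) _ _ W(1) eq]) (use \<phi>m a in \<open>auto simp: l'_def\<close>)
    then show ?thesis
      by (simp add: skyscraper_simps)
  qed
  \<comment> \<open>For the same reason the value may be computed over \<open>W\<close>, where the
    evaluation has its explicit form.\<close>
  moreover have "\<phi> V (evaluation X F L V s l) = res (skyscraper x) V W (\<phi> V (evaluation X F L V s l))"
    using W(1) by (simp add: skyscraper_simps)
  moreover have "\<dots> = \<phi> W (pairing_sum F L W l' n m a)"
    unfolding l'_def v[symmetric]
    by (rule sheaf_hom_res[OF \<phi> V W_open W(2) F.evaluation_represents(1)[OF s V l], symmetric])
  moreover have "\<dots> = (\<Oplus>\<^bsub>sec (skyscraper x) W\<^esub>k\<in>{..<n}. \<phi> W (pairing L W l' (a k) \<odot>\<^bsub>sec F W\<^esub> m k))"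
    using m a F.pairing_closed[OF W_open l']
    by (intro hom_finsum[OF FW.abelian_group_axioms SW.abelian_group_axioms sheaf_hom_hom[OF \<phi> W_open]] FW.smult_closed) auto
  moreover have "\<dots> = pairing_sum (skyscraper x) L W l' n (\<lambda>k. \<phi> W (m k)) a"
    using m a F.pairing_closed[OF W_open l'] \<phi>m
    by (intro SW.finsum_cong') (auto simp: sheaf_hom_smult[OF \<phi> W_open] intro!: SW.smult_closed)
  ultimately show ?thesis by simp
qed

theorem proposition2p10:
  fixes X :: "pt set" and n :: nat and F :: "'a presheaf"
  assumes "smooth_projective_variety X" and "irregular X"
    and "variety_dim X = enat n" and "n \<ge> 2"
    and "coherent_sheaf X F" and "nonzero_sheaf X F"
    and "continuously_globally_generated X F"
  shows "no_essential_basepoints X F"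
  unfolding no_essential_basepoints_def
proof (intro ballI notI)
  fix x assume x: "x \<in> X" and "essential_basepoint X F x"
  then obtain \<phi> where \<phi>: "sheaf_hom X F (skyscraper x) \<phi>"
    and surj: "locally_all X (skyscraper x) (\<lambda>U. \<phi> U ` carrier (sec F U))"
    and zero: "\<And>p L s. p \<in> Pic0 X \<Longrightarrow> L \<in> p \<Longrightarrow> s \<in> global_sections X (tensor_sheaf X F (line_sheaf L)) \<Longrightarrow>
      tensor_sheaf_map X F (skyscraper x) (line_sheaf L) \<phi> X s =
        \<zero>\<^bsub>sec (tensor_sheaf X (skyscraper x) (line_sheaf L)) X\<^esub>"
    unfolding essential_basepoint_def surjective_hom_def by blast
  have sheaf: "module_sheaf X F"
    using assms(5) by (simp add: coherent_sheaf_def)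
  then have presheaf: "module_presheaf X F"
    by (simp add: module_sheaf_def)
  obtain N where "closedin (zar (proj N)) X"
    using assms(1) by (auto simp: smooth_projective_variety_def projective_variety_def)
  then have X: "X \<subseteq> points"
    using closedin_subset by (fastforce simp: zar_def topspace_zariski)
  have generated: "locally_all X F (evaluation_image X F (Pic0 X))"
    using assms(7) Pic0_open_Pic0 Pic0_nonempty[OF X] by (auto simp: continuously_globally_generated_def)
  \<comment> \<open>Surjectivity is used on the section 1 only: near \<open>x\<close> it has a
    preimage \<open>t\<close>, and the value 1 survives every restriction to a neighbourhood of
    \<open>x\<close>.\<close>
  have "(1::complex) \<in> carrier (sec (skyscraper x) X)"
    using x by (simp add: skyscraper_simps)
  then obtain U where U: "openin (zar X) U" "x \<in> U"
    and "res (skyscraper x) X U 1 \<in> \<phi> U ` carrier (sec F U)"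
    using surj[unfolded locally_all_def, THEN spec, of X, THEN spec, of 1] openin_zar_self[OF X] x by blast
  then obtain t where t: "t \<in> carrier (sec F U)" and \<phi>t: "\<phi> U t = 1"
    by (auto simp: skyscraper_simps)
  obtain V where V: "openin (zar X) V" "x \<in> V" "V \<subseteq> U" and t_V: "res F U V t \<in> evaluation_image X F (Pic0 X) V"
    using generated[unfolded locally_all_def, THEN spec, of U, THEN spec, of t] U t by blast
  obtain n :: nat and L s l where t_eq: "res F U V t = (\<Oplus>\<^bsub>sec F V\<^esub>k\<in>{..<n}. evaluation X F (L k) V (s k) (l k))"
    and Lsl: "\<forall>k<n. (\<exists>p\<in>Pic0 X. L k \<in> p) \<and> s k \<in> global_sections X (tensor_sheaf X F (line_sheaf (L k))) \<and>
          l k \<in> carrier (sec (line_sheaf (dual_bundle (L k))) V)"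
    using t_V unfolding evaluation_image_def by (elim CollectE exE conjE) (rule that)
  interpret M: module "reg V" "sec F V"
    by (rule module_presheaf_module[OF presheaf V(1)])
  interpret S: module "reg V" "sec (skyscraper x) V"
    by (rule module_presheaf_module[OF skyscraper_module_presheaf V(1)])
  have eval: "evaluation X F (L k) V (s k) (l k) \<in> carrier (sec F V)"
    "\<phi> V (evaluation X F (L k) V (s k) (l k)) = 0" if "k < n" for k
  proof -
    \<comment> \<open>The bundles \<open>L k\<close> may lie in different classes, so each summand
      is treated in its own twist.\<close>
    obtain p where p: "p \<in> Pic0 X" "L k \<in> p"
      using Lsl \<open>k < n\<close> by blast
    interpret line_bundle_sheaf_twist X F "L k"
      by unfold_locales (fact sheaf, rule Pic0_line_bundle[OF p])
    show "evaluation X F (L k) V (s k) (l k) \<in> carrier (sec F V)"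
      using Lsl \<open>k < n\<close> evaluation_represents(1)[OF _ V(1)] by blast
    show "\<phi> V (evaluation X F (L k) V (s k) (l k)) = 0"
      using Lsl \<open>k < n\<close> zero[OF p] by (intro evaluation_in_kernel[OF sheaf X L_bundle \<phi> _ _ V(1,2)]) auto
  qed
  have "\<phi> V (res F U V t) = (\<Oplus>\<^bsub>sec (skyscraper x) V\<^esub>k\<in>{..<n}. \<phi> V (evaluation X F (L k) V (s k) (l k)))"
    unfolding t_eq
    by (rule hom_finsum[OF M.abelian_group_axioms S.abelian_group_axioms sheaf_hom_hom[OF \<phi> V(1)] eval(1)])
  also have "\<dots> = (\<Oplus>\<^bsub>sec (skyscraper x) V\<^esub>k\<in>{..<n}. \<zero>\<^bsub>sec (skyscraper x) V\<^esub>)"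
    using eval(2) by (intro S.finsum_cong') (auto simp: skyscraper_simps)
  also have "\<dots> = 0"
    by (simp add: S.finsum_zero) (simp add: skyscraper_simps)
  finally have "\<phi> V (res F U V t) = 0" .
  moreover have "\<phi> V (res F U V t) = 1"
    using sheaf_hom_res[OF \<phi> U(1) V(1,3) t] V(2) by (simp add: \<phi>t skyscraper_simps)
  ultimately show False by simp
qed

end
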